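(* Let $d\in\{-4,8\}$. Let $\mathbf r=(r_1,r_2)\in\{1,9\}^2$ with $r_1r_2\equiv1\pmod{16}$ if $d=8$, let $\mathbf s=(s_1,s_2)\in\{\pm1\}^2$ with $s_1s_2=1$, and let $\mathbf e=(e_1,e_2)\in\{0,1\}^2$ with $\mathbf e\neq(0,0)$. With $f(p,q)=f(p,q;\mathbf r,\mathbf s,\mathbf e)$ as in the context, $$\sum_{\substack{p<q \text{ primes}\\ pq\le X}} f(p,q)=o\!\left(\frac{X\log\log X}{\log X}\right)\qquad (X\to\infty).$$
   Context: Let $d_0=d/4$, $R=\mathbb{Z}[\sqrt{d_0}]$ with conjugation $a\mapsto\bar a$ and norm $\mathrm{N}$. For a prime ideal $\mathfrak p\nmid 2$ of $R$ and $a\in R$, $\left(\frac{a}{\mathfrak p}\right)$ is $0$ if $a\in\mathfrak p$, else $\pm1$ according as $a$ is or is not a square mod $\mathfrak p$; extend multiplicatively to ideals coprime to $2$. Let $t=1+i$ if $d=-4$ and $t=\sqrt2$ if $d=8$; for a prime $p\equiv1\pmod 8$ let $\chi_2(p)=\left(\frac{t}{\mathfrak p}\right)$ for any prime ideal $\mathfrak p$ of $R$ above $p$. For primes $p,q\equiv 1\pmod 8$ fix prime elements $w,z\in R$ with $\mathrm{N}(w)=p$, $\mathrm{N}(z)=q$, each congruent to a square mod $4R$, let $\alpha=wz$ and $\varepsilon(p,q)=\left(\frac{\bar\alpha}{(w)}\right)$. Let $\chi_p(q)=\left(\frac{p}{q}\right)$ (Legendre symbol). For primes $p,q$ define $f(p,q;\mathbf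 r,\mathbf s,\mathbf e)=\chi_p(q)^{e_1}\varepsilon(p,q)^{e_2}$ (with the convention $u^0=1$) if $p\equiv r_1$, $q\equiv r_2\pmod{16}$, $\chi_2(p)=s_1$ and $\chi_2(q)=s_2$, and $f(p,q;\mathbf r,\mathbf s,\mathbf e)=0$ otherwise. *)

theory Defs
  imports
    "HOL-Algebra.Ring_Divisibility"
    "HOL-Number_Theory.Number_Theory"
    "HOL-Library.Landau_Symbols"
begin

hide_const (open) Divisibility.prime

text \<open>
  The ring \<open>\<int>[\<surd>d\<^sub>0]\<close> with \<open>d\<^sub>0 = d / 4\<close>, in coordinates: the pair \<open>(a, b)\<close> stands for
  \<open>a + b \<surd>d\<^sub>0\<close>. The intended values of \<open>d\<close> are \<open>-4\<close> and \<open>8\<close>.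
\<close>

definition quad_ring :: "int \<Rightarrow> (int \<times> int) ring" where
  "quad_ring d =
     \<lparr>carrier = UNIV,
      monoid.mult = (\<lambda>(a, b) (a', b'). (a * a' + (d div 4) * b * b', a * b' + b * a')),
      one = (1, 0),
      zero = (0, 0),
      add = (\<lambda>(a, b) (a', b'). (a + a', b + b'))\<rparr>"

definition quad_conj :: "int \<times> int \<Rightarrow> int \<times> int" where
  "quad_conj = (\<lambda>(a, b). (a, - b))"

definition quad_norm :: "int \<Rightarrow> int \<times> int \<Rightarrow> int" where
  "quad_norm d = (\<lambda>(a, b). a\<^sup>2 - (d div 4) * b\<^sup>2)"

lemma quad_ring_simps [simp]:
  "carrier (quad_ring d) = UNIV"
  "(a, b) \<otimes>\<^bsub>quad_ring d\<^esub> (a', b') = (a * a' + (d div 4) * b * b', a * b' + b * a')"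
  "\<one>\<^bsub>quad_ring d\<^esub> = (1, 0)"
  "\<zero>\<^bsub>quad_ring d\<^esub> = (0, 0)"
  "(a, b) \<oplus>\<^bsub>quad_ring d\<^esub> (a', b') = (a + a', b + b')"
  by (simp_all add: quad_ring_def)

lemma cring_quad_ring: "cring (quad_ring d)"
proof (rule cringI)
  show "abelian_group (quad_ring d)"
  proof (rule abelian_groupI)
    fix x assume "x \<in> carrier (quad_ring d)"
    show "\<exists>y\<in>carrier (quad_ring d). y \<oplus>\<^bsub>quad_ring d\<^esub> x = \<zero>\<^bsub>quad_ring d\<^esub>"
      by (cases x, rule bexI[of _ "(- fst x, - snd x)"]) simp_all
  qed auto
  show "Group.comm_monoid (quad_ring d)"
    by (rule comm_monoidI) (auto simp: algebra_simps)
qed (auto simp: algebra_simps)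

lemma quad_norm_conv_conj: "x \<otimes>\<^bsub>quad_ring d\<^esub> quad_conj x = (quad_norm d x, 0)"
  by (cases x) (simp add: quad_norm_def quad_conj_def power2_eq_square)

text \<open>The quadratic residue symbol modulo a prime ideal \<open>P\<close> not dividing \<open>2\<close>.\<close>

definition quad_symbol :: "int \<Rightarrow> int \<times> int \<Rightarrow> (int \<times> int) set \<Rightarrow> int" where
  "quad_symbol d a P =
     (if a \<in> P then 0
      else if \<exists>x\<in>carrier (quad_ring d). (x \<otimes>\<^bsub>quad_ring d\<^esub> x) \<ominus>\<^bsub>quad_ring d\<^esub> a \<in> P then 1
      else - 1)"

text \<open>\<open>1 + i\<close> for \<open>d = -4\<close> and \<open>\<surd>2\<close> for \<open>d = 8\<close>.\<close>

definition quad_t :: "int \<Rightarrow> int \<times> int" where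
  "quad_t d = (if d = - 4 then (1, 1) else (0, 1))"

text \<open>
  For a prime \<open>p \<equiv> 1 (mod 8)\<close> the symbol does not depend on the prime ideal above \<open>p\<close>.
\<close>

definition chi2 :: "int \<Rightarrow> nat \<Rightarrow> int" where
  "chi2 d p =
     (THE s. \<forall>P. primeideal P (quad_ring d) \<and> (int p, 0) \<in> P \<longrightarrow> quad_symbol d (quad_t d) P = s)"

text \<open>
  A fixed choice, for every prime \<open>p \<equiv> 1 (mod 8)\<close>, of a prime element of norm \<open>p\<close> that is
  congruent to a square modulo \<open>4\<close>. The symbol \<open>\<epsilon>(p, q)\<close> below depends on this choice
  (replacing \<open>z\<close> by its conjugate multiplies it by the Legendre symbol of \<open>q\<close> modulo \<open>p\<close>).
\<close>

definition prime_choice :: "int \<Rightarrow> (nat \<Rightarrow> int \<times> int) \<Rightarrow> bool" where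
  "prime_choice d \<pi> \<longleftrightarrow>
     (\<forall>p. prime p \<and> [p = 1] (mod 8) \<longrightarrow>
        \<pi> p \<in> carrier (quad_ring d) \<and>
        ring_prime\<^bsub>quad_ring d\<^esub> (\<pi> p) \<and>
        quad_norm d (\<pi> p) = int p \<and>
        (\<exists>x\<in>carrier (quad_ring d).
           \<pi> p \<ominus>\<^bsub>quad_ring d\<^esub> (x \<otimes>\<^bsub>quad_ring d\<^esub> x) \<in> PIdl\<^bsub>quad_ring d\<^esub> (4, 0)))"

definition eps :: "int \<Rightarrow> (nat \<Rightarrow> int \<times> int) \<Rightarrow> nat \<Rightarrow> nat \<Rightarrow> int" where
  "eps d \<pi> p q =
     (let w = \<pi> p; z = \<pi> q; \<alpha> = w \<otimes>\<^bsub>quad_ring d\<^esub> z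
      in quad_symbol d (quad_conj \<alpha>) (PIdl\<^bsub>quad_ring d\<^esub> w))"

definition f_pq ::
  "int \<Rightarrow> (nat \<Rightarrow> int \<times> int) \<Rightarrow> nat \<times> nat \<Rightarrow> int \<times> int \<Rightarrow> nat \<times> nat \<Rightarrow> nat \<Rightarrow> nat \<Rightarrow> int" where
  "f_pq d \<pi> = (\<lambda>(r1, r2) (s1, s2) (e1, e2) p q.
     if [p = r1] (mod 16) \<and> [q = r2] (mod 16) \<and> chi2 d p = s1 \<and> chi2 d q = s2
     then Legendre (int p) (int q) ^ e1 * eps d \<pi> p q ^ e2
     else 0)"

end

theory Submission
  imports Defs "HOL-Analysis.Convex" "HOL-Real_Asymp.Real_Asymp"
begin

text \<open>
  Reducing modulo \<open>w\<close> sends \<open>\<surd>d\<^sub>0\<close> to an integer \<open>c\<close> with \<open>c\<^sup>2 \<equiv> d\<^sub>0 (mod p)\<close>, so every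
  nonzero \<open>f(p, q)\<close> is a factor depending on \<open>p\<close> only times the Legendre symbol of
  \<open>x + c y\<close> modulo \<open>p\<close>, where \<open>(x, y)\<close> is either \<open>(q, 0)\<close> or, up to sign and squares of units, \<open>z\<close> or its
  conjugate, and \<open>(x, y)\<close> may be taken in a fundamental domain.

  Put \<open>P\<^sub>0 = (log X)\<^sup>4\<close> and \<open>P\<^sub>1 = X\<^bsup>1/10\<^esup>\<close>. By Chebyshev's bound the pairs with \<open>p \<le> P\<^sub>0\<close> or
  \<open>p > P\<^sub>1\<close> number \<open>O(X log log log X / log X)\<close>. For \<open>P\<^sub>0 < p \<le> P\<^sub>1\<close> apply Cauchy--Schwarz, enlarging
  the sum over \<open>q\<close> to all lattice points \<open>(x, y)\<close> of norm at most \<open>X / P\<^sub>0\<close>. The diagonal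
  contributes little because \<open>P\<^sub>0\<close> exceeds a power of \<open>log X\<close>; for \<open>p \<noteq> p'\<close> the sum over \<open>x\<close> runs
  over an interval and is at most \<open>p p'\<close>, since the product of the two symbols has period
  \<open>p p'\<close> and sums to zero over a period.
\<close>

section \<open>Chebyshev bounds\<close>

text \<open>With \<open>n = 2 ^ k\<close>, each prime in \<open>A\<close> divides the numerator of
  \<open>2 * n choose n\<close> but not its denominator, so the product of all of them divides a
  number that is at most \<open>4 ^ n\<close>. That product is at least \<open>n ^ card A\<close>,
  and comparing exponents of 2 gives the bound.\<close>

lemma card_primes_dyadic:
  "k * card {p. prime p \<and> 2 ^ k < p \<and> p \<le> (2 ^ Suc k :: nat)} \<le> 2 ^ Suc k"
proof -
  define n :: nat where "n = 2 ^ k"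
  define A where "A = {p::nat. prime p \<and> n < p \<and> p \<le> 2 * n}"
  have "finite A" unfolding A_def by (rule finite_subset[of _ "{..2 * n}"]) auto
  have dvd: "p dvd (2 * n choose n)" if "p \<in> A" for p
  proof -
    have p: "prime p" "n < p" "p \<le> 2 * n" using that by (auto simp: A_def)
    have "fact (2 * n) = (fact n * fact n * (2 * n choose n) :: nat)"
      using binomial_fact_lemma[of n "2 * n"] by (simp add: mult_ac)
    moreover have "p dvd fact (2 * n)" using p by (simp add: prime_dvd_fact_iff)
    moreover have "\<not> p dvd fact n" using p by (simp add: prime_dvd_fact_iff)
    ultimately show ?thesis using p(1) by (simp add: prime_dvd_mult_iff)
  qed
  have "\<Prod>B dvd (2 * n choose n)" if "finite B" "B \<subseteq> A" for B
    using that
  proof (induction B rule: finite_induct)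
    case (insert p B)
    have "coprime p (\<Prod>B)"
      using insert by (intro prod_coprime_right primes_coprime) (auto simp: A_def)
    then show ?case using insert dvd by (auto intro: divides_mult)
  qed simp
  from this[OF \<open>finite A\<close> order_refl] have "\<Prod>A dvd (2 * n choose n)" .
  then have "\<Prod>A \<le> (2 * n choose n)" by (rule dvd_imp_le) simp
  also have "\<dots> \<le> 2 ^ (2 * n)" by (rule binomial_le_pow2)
  finally have "\<Prod>A \<le> 2 ^ (2 * n)" .
  moreover have "n ^ card A \<le> \<Prod>A"
  proof -
    have "n ^ card A = (\<Prod>p\<in>A. n)" by simp
    also have "\<dots> \<le> \<Prod>A" by (rule prod_mono) (auto simp: A_def)
    finally show ?thesis .
  qed
  ultimately have "(2::nat) ^ (k * card A) \<le> 2 ^ (2 * n)"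
    by (simp add: n_def power_mult)
  then have "k * card A \<le> 2 * n" by (simp add: power_increasing_iff)
  then show ?thesis by (simp add: n_def A_def)
qed

definition primes_le :: "nat \<Rightarrow> nat set" where
  "primes_le n = {p. prime p \<and> p \<le> n}"

lemma finite_primes_le [simp]: "finite (primes_le n)"
  unfolding primes_le_def by (rule finite_subset[of _ "{..n}"]) auto

text \<open>Dyadic blocks are added one at a time. The induction starts at 3 because its step needs
  \<open>6 * k + 6 \<le> 8 * k\<close>; smaller exponents are covered by counting all
  integers.\<close>

lemma card_primes_le_power2: "k * card (primes_le (2 ^ k)) \<le> 4 * 2 ^ k"
proof (cases "k < 3")
  case True
  have "card (primes_le (2 ^ k)) \<le> card {2..(2::nat) ^ k}"
    by (rule card_mono) (auto simp: primes_le_def prime_ge_2_nat)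
  then have "card (primes_le (2 ^ k)) \<le> 2 ^ k" by simp
  then have "k * card (primes_le (2 ^ k)) \<le> k * 2 ^ k" by simp
  also have "\<dots> \<le> 4 * 2 ^ k" using True by simp
  finally show ?thesis .
next
  case False
  then have "3 \<le> k" by simp
  then show ?thesis
  proof (induction k rule: dec_induct)
    case base
    have "card (primes_le (2 ^ 3)) \<le> card {1..8::nat}"
      by (rule card_mono) (auto simp: primes_le_def prime_ge_Suc_0_nat)
    then show ?case by simp
  next
    case (step k)
    define B where "B = {p. prime p \<and> 2 ^ k < p \<and> p \<le> (2 ^ Suc k :: nat)}"
    have "primes_le (2 ^ Suc k) \<subseteq> primes_le (2 ^ k) \<union> B"
      unfolding primes_le_def B_def by auto
    moreover have "finite B" unfolding B_def by (rule finite_subset[of _ "{..2 ^ Suc k}"]) auto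
    ultimately have "card (primes_le (2 ^ Suc k)) \<le> card (primes_le (2 ^ k) \<union> B)"
      by (intro card_mono) auto
    also have "\<dots> \<le> card (primes_le (2 ^ k)) + card B" by (rule card_Un_le)
    \<comment> \<open>The extra factor \<open>k\<close> puts both summands into the shape bounded by
      the induction hypothesis and by the dyadic count; it is cancelled at the end.\<close>
    finally have "k * (Suc k * card (primes_le (2 ^ Suc k)))
        \<le> Suc k * (k * card (primes_le (2 ^ k)) + k * card B)"
      by (simp only: distrib_left[symmetric] mult.left_commute[of k] mult_le_mono)
    also have "\<dots> \<le> Suc k * (4 * 2 ^ k + 2 ^ Suc k)"
      using step.IH card_primes_dyadic[of k] unfolding B_def by (intro mult_le_mono2 add_mono)
    also have "\<dots> = (6 * k + 6) * 2 ^ k" by (simp add: algebra_simps)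
    also have "\<dots> \<le> (8 * k) * 2 ^ k" using step.hyps by (intro mult_le_mono) auto
    also have "\<dots> = k * (4 * 2 ^ Suc k)" by simp
    finally show ?case using step.hyps by simp
  qed
qed

text \<open>Round \<open>x\<close> up to a power of two, which at most doubles it: hence 8 in place
  of 4. The exponent \<open>k\<close> is at least \<open>ln x\<close> because
  \<open>ln 2 < 1\<close>.\<close>

theorem chebyshev_upper:
  fixes x :: real
  assumes "x \<ge> 2"
  shows "real (card (primes_le (nat \<lfloor>x\<rfloor>))) \<le> 8 * x / ln x"
proof -
  define k where "k = nat \<lceil>log 2 x\<rceil>"
  have lx: "log 2 x \<ge> 1" using assms by simp
  then have k1: "real k \<ge> log 2 x" "real k < log 2 x + 1" "k \<ge> 1"
    unfolding k_def by linarith+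
  have "x = 2 powr (log 2 x)" using assms by simp
  also have "\<dots> \<le> 2 powr real k" using k1 by simp
  also have "\<dots> = 2 ^ k" by (simp add: powr_realpow)
  finally have xk: "x \<le> 2 ^ k" .
  have "2 ^ k = (2::real) powr real k" by (simp add: powr_realpow)
  also have "\<dots> \<le> 2 powr (log 2 x + 1)" using k1 by simp
  also have "\<dots> = 2 * x" using assms by (simp add: powr_add)
  finally have kx: "2 ^ k \<le> 2 * x" .
  have "nat \<lfloor>x\<rfloor> \<le> 2 ^ k"
  proof -
    have "real (nat \<lfloor>x\<rfloor>) \<le> x" using assms by simp
    also have "x \<le> real (2 ^ k)" using xk by simp
    finally show ?thesis by (simp only: of_nat_le_iff)
  qed
  then have "primes_le (nat \<lfloor>x\<rfloor>) \<subseteq> primes_le (2 ^ k)"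
    unfolding primes_le_def using order_trans by blast
  then have "card (primes_le (nat \<lfloor>x\<rfloor>)) \<le> card (primes_le (2 ^ k))"
    by (intro card_mono) auto
  then have "real k * real (card (primes_le (nat \<lfloor>x\<rfloor>))) \<le> real (k * card (primes_le (2 ^ k)))"
    by (simp add: mult_left_mono)
  also have "\<dots> \<le> real (4 * 2 ^ k)" using card_primes_le_power2[of k] by (simp only: of_nat_le_iff)
  also have "\<dots> \<le> 8 * x" using kx by simp
  finally have *: "real k * real (card (primes_le (nat \<lfloor>x\<rfloor>))) \<le> 8 * x" .
  have "ln x = ln 2 * log 2 x" by (simp add: log_def)
  also have "\<dots> \<le> 1 * log 2 x" using lx ln_2_less_1 by (intro mult_right_mono) auto
  finally have "ln x \<le> real k" using k1 by simp
  then have "ln x * real (card (primes_le (nat \<lfloor>x\<rfloor>))) \<le> 8 * x"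
    using * by (meson mult_right_mono of_nat_0_le_iff order_trans)
  moreover have "ln x > 0" using assms by simp
  ultimately show ?thesis by (simp add: field_simps)
qed

section \<open>Sums of reciprocals of primes\<close>

lemma sum_inverse_primes_dyadic:
  assumes "k \<ge> 1"
  shows "(\<Sum>p | prime p \<and> 2 ^ k < p \<and> p \<le> (2 ^ Suc k :: nat). 1 / real p) \<le> 2 / real k"
proof -
  let ?B = "{p. prime p \<and> 2 ^ k < p \<and> p \<le> (2 ^ Suc k :: nat)}"
  have "1 / real p \<le> 1 / 2 ^ k" if "p \<in> ?B" for p
  proof -
    have "real (2 ^ k) \<le> real p" using that by (simp only: of_nat_le_iff) simp
    then show ?thesis using that by (intro divide_left_mono) (auto simp: prime_gt_0_nat)
  qed
  then have "(\<Sum>p\<in>?B. 1 / real p) \<le> (\<Sum>p\<in>?B. 1 / 2 ^ k)" by (rule sum_mono)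
  also have "\<dots> = real (card ?B) / 2 ^ k" by simp
  also have "\<dots> \<le> 2 / real k"
  proof -
    have "real (k * card ?B) \<le> real (2 ^ Suc k)"
      using card_primes_dyadic[of k] by (simp only: of_nat_le_iff)
    then have "real k * real (card ?B) \<le> 2 * 2 ^ k" by (simp only: of_nat_mult of_nat_power power_Suc) simp
    then show ?thesis using assms by (simp add: field_simps)
  qed
  finally show ?thesis .
qed

lemma sum_inverse_primes_between:
  assumes "1 \<le> j" "j \<le> m"
  shows "(\<Sum>p | prime p \<and> 2 ^ j < p \<and> p \<le> (2 ^ m :: nat). 1 / real p) \<le> (\<Sum>k=j..<m. 2 / real k)"
  using assms(2)
proof (induction m rule: dec_induct)
  case base
  have empty: "{p. prime p \<and> 2 ^ j < p \<and> p \<le> (2 ^ j :: nat)} = {}" by auto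
  show ?case unfolding empty by simp
next
  case (step m)
  have fin: "finite {p. prime p \<and> a < p \<and> p \<le> (b :: nat)}" for a b
    by (rule finite_subset[of _ "{..b}"]) auto
  have le: "(2::nat) ^ j \<le> 2 ^ m" using step.hyps by (intro power_increasing) auto
  have "{p. prime p \<and> 2 ^ j < p \<and> p \<le> (2 ^ Suc m :: nat)}
      = {p. prime p \<and> 2 ^ j < p \<and> p \<le> (2 ^ m :: nat)} \<union> {p. prime p \<and> 2 ^ m < p \<and> p \<le> (2 ^ Suc m :: nat)}"
    using order.strict_trans1[OF le] by auto
  then have "(\<Sum>p | prime p \<and> 2 ^ j < p \<and> p \<le> (2 ^ Suc m :: nat). 1 / real p)
      = (\<Sum>p | prime p \<and> 2 ^ j < p \<and> p \<le> (2 ^ m :: nat). 1 / real p)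
      + (\<Sum>p | prime p \<and> 2 ^ m < p \<and> p \<le> (2 ^ Suc m :: nat). 1 / real p)"
    by (simp only:) (rule sum.union_disjoint; (rule fin)?; auto)
  also have "\<dots> \<le> (\<Sum>k=j..<m. 2 / real k) + 2 / real m"
    using step assms(1) by (intro add_mono step.IH sum_inverse_primes_dyadic) auto
  finally show ?case using step.hyps by simp
qed

lemma sum_inverse_le_ln:
  assumes "n \<ge> 1"
  shows "(\<Sum>k=1..n. 1 / real k) \<le> 1 + ln (real n)"
  using assms
proof (induction n rule: dec_induct)
  case (step n)
  have "ln (real n / real (Suc n)) \<le> real n / real (Suc n) - 1"
    using step.hyps by (intro ln_le_minus_one) simp
  also have "\<dots> = - (1 / real (Suc n))" by (simp add: field_simps)
  finally have "1 / real (Suc n) \<le> ln (real (Suc n)) - ln (real n)"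
    using step.hyps by (simp add: ln_div)
  then show ?case using step.IH by simp
qed simp

text \<open>An upper bound of Mertens type: the dyadic block with index \<open>k\<close> contributes
  at most \<open>2 / k\<close>, and about \<open>log 2 y\<close> blocks occur, so a harmonic sum of
  that length bounds the total.\<close>

lemma sum_inverse_primes_le:
  fixes y :: real
  assumes "y \<ge> 2"
  shows "(\<Sum>p | prime p \<and> real p \<le> y. 1 / real p) \<le> 3 + 2 * ln (log 2 y + 1)"
proof -
  define m where "m = nat \<lceil>log 2 y\<rceil>"
  have ly: "log 2 y \<ge> 1" using assms by simp
  then have m: "real m \<ge> log 2 y" "real m < log 2 y + 1" "m \<ge> 1"
    unfolding m_def by linarith+
  have "y = 2 powr (log 2 y)" using assms by simp
  also have "\<dots> \<le> 2 powr real m" using m by simp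
  also have "\<dots> = real (2 ^ m)" by (simp add: powr_realpow)
  finally have ym: "y \<le> real (2 ^ m)" .
  have le: "p \<le> 2 ^ m" if "real p \<le> y" for p
    using that ym by (metis of_nat_le_iff order_trans)
  let ?C = "{p. prime p \<and> 2 ^ 1 < p \<and> p \<le> (2 ^ m :: nat)}"
  have finC: "finite ?C" by (rule finite_subset[of _ "{..2 ^ m}"]) auto
  \<comment> \<open>The dyadic blocks start above 2, so the prime 2 is put in by hand.\<close>
  have "{p. prime p \<and> real p \<le> y} \<subseteq> insert 2 ?C"
  proof
    fix p assume p: "p \<in> {p. prime p \<and> real p \<le> y}"
    then have "p \<ge> 2" "p \<le> 2 ^ m" using le by (auto simp: prime_ge_2_nat)
    then show "p \<in> insert 2 ?C" using p by (cases "p = 2") auto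
  qed
  then have "(\<Sum>p | prime p \<and> real p \<le> y. 1 / real p) \<le> (\<Sum>p\<in>insert 2 ?C. 1 / real p)"
    using finC by (intro sum_mono2) auto
  also have "\<dots> = 1 / 2 + (\<Sum>p\<in>?C. 1 / real p)" using finC by (subst sum.insert) auto
  also have "(\<Sum>p\<in>?C. 1 / real p) \<le> (\<Sum>k=1..<m. 2 / real k)"
    using m by (intro sum_inverse_primes_between) auto
  also have "(\<Sum>k=1..<m. 2 / real k) \<le> (\<Sum>k=1..m. 2 / real k)"
    by (intro sum_mono2) auto
  also have "\<dots> = 2 * (\<Sum>k=1..m. 1 / real k)" by (simp add: sum_distrib_left)
  also have "\<dots> \<le> 2 * (1 + ln (real m))" using sum_inverse_le_ln[of m] m by simp
  also have "ln (real m) \<le> ln (log 2 y + 1)" using m by simp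
  finally show ?thesis by simp
qed

text \<open>On a logarithmic scale the range runs from \<open>L / 10\<close> to
  \<open>L / 2\<close>: the number of dyadic blocks is proportional to \<open>L\<close> and each
  contributes a constant over \<open>L\<close>, so the sum stays bounded.\<close>

lemma sum_inverse_primes_root_range:
  fixes X :: real
  assumes "X \<ge> 2 ^ 20"
  shows "(\<Sum>p | prime p \<and> X powr (1/10) < real p \<and> real p \<le> sqrt X. 1 / real p) \<le> 14"
proof -
  define L where "L = log 2 X"
  have X0: "X > 0" using assms by (rule less_le_trans[rotated]) simp
  have "20 = log 2 (2 ^ 20)" by (subst log_pow_cancel) auto
  also have "\<dots> \<le> L" unfolding L_def using assms X0 by (intro log_mono) auto
  finally have L: "L \<ge> 20" .
  have XL: "X = 2 powr L" using X0 by (simp add: L_def)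
  define j where "j = nat \<lfloor>L / 10\<rfloor>"
  define m where "m = nat \<lceil>L / 2\<rceil>"
  have j: "real j \<le> L / 10" "real j > L / 10 - 1" "j \<ge> 2" unfolding j_def using L by linarith+
  have m: "real m \<ge> L / 2" "real m < L / 2 + 1" unfolding m_def using L by linarith+
  have jm: "j \<le> m" using j m L by linarith
  have lo: "real (2 ^ j) \<le> X powr (1/10)"
  proof -
    have "real (2 ^ j) = 2 powr real j" by (simp add: powr_realpow)
    also have "\<dots> \<le> 2 powr (L / 10)" using j by simp
    finally show ?thesis by (simp add: XL powr_powr)
  qed
  have hi: "sqrt X \<le> real (2 ^ m)"
  proof -
    have "sqrt X = 2 powr (L / 2)" using X0 by (simp add: XL powr_powr flip: powr_half_sqrt)
    also have "\<dots> \<le> 2 powr real m" using m by simp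
    finally show ?thesis by (simp add: powr_realpow)
  qed
  let ?C = "{p. prime p \<and> 2 ^ j < p \<and> p \<le> (2 ^ m :: nat)}"
  have finC: "finite ?C" by (rule finite_subset[of _ "{..2 ^ m}"]) auto
  have "{p. prime p \<and> X powr (1/10) < real p \<and> real p \<le> sqrt X} \<subseteq> ?C"
  proof (intro subsetI CollectI conjI; elim CollectE conjE)
    fix p assume "X powr (1/10) < real p"
    then have "real (2 ^ j) < real p" using lo by linarith
    then show "2 ^ j < p" by (simp only: of_nat_less_iff)
  next
    fix p assume "real p \<le> sqrt X"
    then have "real p \<le> real (2 ^ m)" using hi by linarith
    then show "p \<le> 2 ^ m" by (simp only: of_nat_le_iff)
  qed
  then have "(\<Sum>p | prime p \<and> X powr (1/10) < real p \<and> real p \<le> sqrt X. 1 / real p)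
      \<le> (\<Sum>p\<in>?C. 1 / real p)" using finC by (intro sum_mono2) auto
  also have "\<dots> \<le> (\<Sum>k=j..<m. 2 / real k)" using j jm by (intro sum_inverse_primes_between) auto
  also have "\<dots> \<le> (\<Sum>k=j..<m. 2 / real j)" using j by (intro sum_mono divide_left_mono) auto
  also have "\<dots> = 2 * (real m - real j) / real j" using jm by (simp add: of_nat_diff)
  also have "\<dots> \<le> 14"
  proof -
    \<comment> \<open>From \<open>L < 10 * (j + 1)\<close> follows \<open>m < 5 * j + 6\<close>.
      Then \<open>8 * j + 12 \<le> 14 * j\<close> because \<open>j \<ge> 2\<close>, which is the
      purpose of \<open>X \<ge> 2 ^ 20\<close>.\<close>
    have "real m - real j \<le> 4 * real j + 6" using j m by linarith
    then have "2 * (real m - real j) \<le> 14 * real j" using \<open>j \<ge> 2\<close>[folded of_nat_le_iff[where 'a = real]] by simp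
    then show ?thesis using j(3) by (simp add: divide_le_eq)
  qed
  finally show ?thesis .
qed

section \<open>Counting pairs of primes\<close>

text \<open>For fixed \<open>p\<close> Chebyshev's bound counts the \<open>q\<close> up to
  \<open>X / p\<close>. Since \<open>p \<le> sqrt X\<close>, the logarithm of \<open>X / p\<close>
  is at least half that of \<open>X\<close>, which turns 8 into 16.\<close>

lemma card_prime_pairs_le:
  fixes X :: real
  assumes "X \<ge> 4" "finite A" and A: "\<And>p. p \<in> A \<Longrightarrow> p \<ge> 1 \<and> real p \<le> sqrt X"
  shows "finite {(p, q). p \<in> A \<and> prime q \<and> real (p * q) \<le> X}"
    and "real (card {(p, q). p \<in> A \<and> prime q \<and> real (p * q) \<le> X})
      \<le> 16 * X / ln X * (\<Sum>p\<in>A. 1 / real p)"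
proof -
  have eq: "{(p, q). p \<in> A \<and> prime q \<and> real (p * q) \<le> X} = (SIGMA p:A. primes_le (nat \<lfloor>X / real p\<rfloor>))"
  proof -
    have "real (p * q) \<le> X \<longleftrightarrow> q \<le> nat \<lfloor>X / real p\<rfloor>" if "p \<in> A" for p q
    proof -
      have "real (p * q) \<le> X \<longleftrightarrow> real q \<le> X / real p"
        using A[OF that] by (simp add: field_simps)
      also have "\<dots> \<longleftrightarrow> q \<le> nat \<lfloor>X / real p\<rfloor>"
        using assms(1) by (subst le_nat_iff) (auto simp: le_floor_iff)
      finally show ?thesis .
    qed
    then show ?thesis by (auto simp: primes_le_def)
  qed
  show "finite {(p, q). p \<in> A \<and> prime q \<and> real (p * q) \<le> X}"
    unfolding eq using assms(2) by auto
  have s2: "sqrt X \<ge> 2" using real_sqrt_le_mono[OF assms(1)] by simp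
  have "real (card (SIGMA p:A. primes_le (nat \<lfloor>X / real p\<rfloor>)))
      = (\<Sum>p\<in>A. real (card (primes_le (nat \<lfloor>X / real p\<rfloor>))))"
    using assms(2) by (simp add: card_SigmaI)
  also have "\<dots> \<le> (\<Sum>p\<in>A. 16 * X / ln X * (1 / real p))"
  proof (rule sum_mono)
    fix p assume "p \<in> A"
    then have p: "p \<ge> 1" "real p \<le> sqrt X" using A by auto
    have "sqrt X * real p \<le> sqrt X * sqrt X" using p s2 assms(1) by (intro mult_left_mono) auto
    then have ge: "X / real p \<ge> sqrt X" using p assms(1) by (simp add: field_simps)
    have "ln X / 2 = ln (sqrt X)" using assms(1) by (simp add: ln_sqrt)
    also have "\<dots> \<le> ln (X / real p)" using ge s2 assms(1) by (intro ln_mono) auto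
    finally have lnge: "ln X / 2 \<le> ln (X / real p)" .
    have lnpos: "ln X > 0" using assms(1) by simp
    have "real (card (primes_le (nat \<lfloor>X / real p\<rfloor>))) \<le> 8 * (X / real p) / ln (X / real p)"
      using ge s2 by (intro chebyshev_upper) linarith
    also have "\<dots> \<le> 8 * (X / real p) / (ln X / 2)"
      using lnge lnpos assms(1) by (intro divide_left_mono mult_pos_pos; (linarith | simp))
    also have "\<dots> = 16 * X / ln X * (1 / real p)" by simp
    finally show "real (card (primes_le (nat \<lfloor>X / real p\<rfloor>))) \<le> 16 * X / ln X * (1 / real p)" .
  qed
  also have "\<dots> = 16 * X / ln X * (\<Sum>p\<in>A. 1 / real p)" by (rule sum_distrib_left[symmetric])
  finally show "real (card {(p, q). p \<in> A \<and> prime q \<and> real (p * q) \<le> X})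
      \<le> 16 * X / ln X * (\<Sum>p\<in>A. 1 / real p)" unfolding eq .
qed

section \<open>Sums of Legendre symbols\<close>

lemma Legendre_cong:
  assumes "[a = b] (mod p)"
  shows "Legendre a p = Legendre b p"
proof -
  have "[a = 0] (mod p) \<longleftrightarrow> [b = 0] (mod p)" using assms cong_sym cong_trans by blast
  moreover have "QuadRes p a \<longleftrightarrow> QuadRes p b"
    unfolding QuadRes_def using assms cong_sym cong_trans by blast
  ultimately show ?thesis by (simp add: Legendre_def)
qed

lemma Legendre_cases: "Legendre a p \<in> {-1, 0, 1}"
  by (simp add: Legendre_def)

lemma Legendre_eq_0_iff: "Legendre a p = 0 \<longleftrightarrow> p dvd a"
  by (simp add: Legendre_def cong_0_iff)

text \<open>Euler's criterion gives the identity modulo \<open>p\<close>. Both sides lie in {-1, 0,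
  1}, so they differ by at most 2, which is less than \<open>p\<close>.\<close>

lemma Legendre_mult:
  fixes p :: nat
  assumes "prime p" "2 < p"
  shows "Legendre (a * b) (int p) = Legendre a (int p) * Legendre b (int p)"
proof -
  let ?k = "(p - 1) div 2"
  have "[Legendre (a * b) p = (a * b) ^ ?k] (mod p)" using euler_criterion assms by blast
  also have "(a * b) ^ ?k = a ^ ?k * b ^ ?k" by (rule power_mult_distrib)
  also have "[a ^ ?k * b ^ ?k = Legendre a p * Legendre b p] (mod p)"
    using euler_criterion[OF assms] by (intro cong_mult) (blast intro: cong_sym)+
  finally have "int p dvd Legendre (a * b) p - Legendre a p * Legendre b p"
    by (simp add: cong_iff_dvd_diff)
  moreover have "\<bar>Legendre (a * b) p - Legendre a p * Legendre b p\<bar> < int p"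
    using Legendre_cases[of "a * b" p] Legendre_cases[of a p] Legendre_cases[of b p] assms(2)
    by auto
  ultimately show ?thesis by (metis abs_of_nat dvd_imp_le_int eq_iff_diff_eq_0 linorder_not_less)
qed

lemma Legendre_square:
  assumes "\<not> p dvd x"  "prime (p::int)"
  shows "Legendre (x * x) p = 1"
proof -
  have "QuadRes p (x * x)" unfolding QuadRes_def by (metis cong_refl power2_eq_square)
  moreover have "\<not> p dvd x * x" using assms by (simp add: prime_dvd_mult_iff)
  ultimately show ?thesis by (simp add: Legendre_def cong_0_iff)
qed

lemma Legendre_minus_1:
  fixes p :: nat
  assumes "prime p" "[p = 1] (mod 4)"
  shows "Legendre (-1) (int p) = 1"
proof -
  have "p mod 4 = 1" using assms(2) by (simp add: unique_euclidean_semiring_class.cong_def)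
  moreover have "p > 1" using assms(1) prime_gt_1_nat by blast
  ultimately have p2: "p > 2" "even ((p - 1) div 2)" by presburger+
  have "[Legendre (-1) p = (-1) ^ ((p - 1) div 2)] (mod p)"
    using euler_criterion[OF assms(1) p2(1)] .
  then have "[Legendre (-1) p = 1] (mod p)" using p2(2) by simp
  then have "int p dvd Legendre (-1) p - 1" by (simp add: cong_iff_dvd_diff)
  moreover have "\<bar>Legendre (-1) p - 1\<bar> < int p" using Legendre_cases[of "-1" p] p2(1) by auto
  ultimately show ?thesis by (metis abs_of_nat dvd_imp_le_int eq_iff_diff_eq_0 linorder_not_less)
qed

text \<open>Otherwise squaring would be onto the residues modulo \<open>p\<close>, hence injective
  on this finite set, although 1 and \<open>p - 1\<close> have the same square.\<close>

lemma exists_nonresidue: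
  fixes p :: nat
  assumes "prime p" "2 < p"
  obtains g where "Legendre g (int p) = -1"
proof (rule ccontr)
  assume "\<not> thesis"
  then have no: "Legendre g (int p) \<noteq> -1" for g using that by blast
  have "{0..<int p} \<subseteq> (\<lambda>y. y\<^sup>2 mod int p) ` {0..<int p}"
  proof
    fix a assume a: "a \<in> {0..<int p}"
    have "QuadRes (int p) a"
    proof (cases "[a = 0] (mod int p)")
      case True
      then show ?thesis unfolding QuadRes_def by (intro exI[of _ 0]) (simp add: cong_sym_eq)
    next
      case False
      then show ?thesis using no[of a] by (auto simp: Legendre_def split: if_splits)
    qed
    then obtain y where "[y\<^sup>2 = a] (mod int p)" unfolding QuadRes_def by blast
    then have "a = (y mod int p)\<^sup>2 mod int p" using a by (simp add: unique_euclidean_semiring_class.cong_def power_mod)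
    moreover have "y mod int p \<in> {0..<int p}" using assms by simp
    ultimately show "a \<in> (\<lambda>y. y\<^sup>2 mod int p) ` {0..<int p}" by blast
  qed
  then have "card {0..<int p} \<le> card ((\<lambda>y. y\<^sup>2 mod int p) ` {0..<int p})"
    by (intro card_mono) auto
  then have "inj_on (\<lambda>y. y\<^sup>2 mod int p) {0..<int p}"
    by (intro eq_card_imp_inj_on antisym card_image_le) auto
  moreover have "(int p - 1)\<^sup>2 mod int p = 1\<^sup>2 mod int p"
  proof -
    have "(int p - 1)\<^sup>2 = 1\<^sup>2 + int p * (int p - 2)" by (simp add: power2_eq_square algebra_simps)
    then show ?thesis by (metis mod_mult_self2)
  qed
  ultimately have "int p - 1 = 1" using assms by (elim inj_onD) auto
  then show False using assms by simp
qed

section \<open>Complete and incomplete sums of periodic functions\<close>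

lemma periodic_mod:
  fixes g :: "int \<Rightarrow> 'a"
  assumes "\<And>x. g (x + m) = g x"
  shows "g (x mod m) = g x"
proof -
  have nat: "g (y + int n * m) = g y" for y n
  proof (induction n)
    case (Suc n)
    then show ?case using assms[of "y + int n * m"] by (simp add: algebra_simps)
  qed simp
  show ?thesis
  proof (cases "x div m \<ge> 0")
    case True
    then show ?thesis using nat[of "x mod m" "nat (x div m)"] by simp
  next
    case False
    then show ?thesis using nat[of x "nat (- (x div m))"]
      by (simp add: minus_div_mult_eq_mod [symmetric])
  qed
qed

text \<open>The map sending \<open>x\<close> to \<open>u * x + v\<close> permutes the residues
  modulo \<open>m\<close>.\<close>

lemma sum_periodic_affine:
  fixes g :: "int \<Rightarrow> real"
  assumes per: "\<And>x. g (x + m) = g x" and "m > 0" "coprime u m"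
  shows "(\<Sum>x\<in>{0..<m}. g (u * x + v)) = (\<Sum>x\<in>{0..<m}. g x)"
proof -
  let ?h = "\<lambda>x. (u * x + v) mod m"
  have inj: "inj_on ?h {0..<m}"
  proof (rule inj_onI)
    fix x y assume xy: "x \<in> {0..<m}" "y \<in> {0..<m}" "?h x = ?h y"
    then have "[u * x + v = u * y + v] (mod m)" by (simp add: unique_euclidean_semiring_class.cong_def)
    then have "[u * x = u * y] (mod m)" by (simp add: cong_add_rcancel)
    then have "[x = y] (mod m)" using assms(3) by (simp add: cong_mult_lcancel)
    then show "x = y" using xy by (simp add: unique_euclidean_semiring_class.cong_def)
  qed
  have "?h ` {0..<m} \<subseteq> {0..<m}" using assms(2) by auto
  then have img: "?h ` {0..<m} = {0..<m}" using inj by (intro endo_inj_surj) auto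
  have "(\<Sum>x\<in>{0..<m}. g x) = (\<Sum>x\<in>?h ` {0..<m}. g x)" by (simp only: img)
  also have "\<dots> = (\<Sum>x\<in>{0..<m}. g (?h x))" using inj by (simp add: sum.reindex)
  also have "\<dots> = (\<Sum>x\<in>{0..<m}. g (u * x + v))" using periodic_mod[of g m, OF per] by simp
  finally show ?thesis ..
qed

text \<open>Full periods are stripped off from the left at no cost until at most \<open>m\<close>
  terms remain, and these are bounded trivially.\<close>

lemma sum_periodic_incomplete:
  fixes g :: "int \<Rightarrow> real"
  assumes per: "\<And>x. g (x + m) = g x" and "m > 0" and zero: "(\<Sum>x\<in>{0..<m}. g x) = 0"
    and bd: "\<And>x. \<bar>g x\<bar> \<le> 1"
  shows "\<bar>\<Sum>x\<in>{l..u}. g x\<bar> \<le> m"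
proof (induction "nat (u - l + 1)" arbitrary: l rule: less_induct)
  case less
  show ?case
  proof (cases "u - l + 1 \<le> m")
    case True
    have "\<bar>\<Sum>x\<in>{l..u}. g x\<bar> \<le> (\<Sum>x\<in>{l..u}. \<bar>g x\<bar>)" by (rule sum_abs)
    also have "\<dots> \<le> (\<Sum>x\<in>{l..u}. 1)" using bd by (intro sum_mono)
    also have "\<dots> \<le> m" using True assms(2) by simp
    finally show ?thesis .
  next
    case False
    have "{l..u} = {l..<l + m} \<union> {l + m..u}" using False assms(2) by auto
    then have "(\<Sum>x\<in>{l..u}. g x) = (\<Sum>x\<in>{l..<l + m}. g x) + (\<Sum>x\<in>{l + m..u}. g x)"
      by (simp only:) (intro sum.union_disjoint; auto)
    also have "(\<Sum>x\<in>{l..<l + m}. g x) = (\<Sum>x\<in>{0..<m}. g (1 * x + l))"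
      by (rule sum.reindex_bij_witness[of _ "\<lambda>x. x + l" "\<lambda>x. x - l"]) auto
    also have "\<dots> = 0" using sum_periodic_affine[of g m 1 l] per assms(2) zero by simp
    finally show ?thesis using less[of "l + m"] assms(2) False by simp
  qed
qed

text \<open>The sum over a full period vanishes: by the Chinese remainder theorem some affine
  substitution multiplies \<open>x + a\<close> by a nonresidue modulo \<open>p\<close> and fixes
  \<open>x\<close> modulo \<open>p'\<close>. It permutes the residues and flips every sign.\<close>

lemma Legendre_pair_sum:
  fixes p p' :: nat
  assumes p: "prime p" "2 < p" and p': "prime p'" "p \<noteq> p'"
  shows "\<bar>\<Sum>x\<in>{l..u}. real_of_int (Legendre (x + a) p * Legendre (x + a') p')\<bar> \<le> real p * real p'"
proof -
  define g where "g = (\<lambda>x. real_of_int (Legendre (x + a) p * Legendre (x + a') p'))"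
  define m where "m = int p * int p'"
  have m: "m > 0" using p p' by (simp add: m_def prime_gt_0_nat)
  have per: "g (x + m) = g x" for x
  proof -
    have "[x + m + a = x + a] (mod p)" "[x + m + a' = x + a'] (mod p')"
      by (simp_all add: cong_iff_dvd_diff m_def)
    then show ?thesis by (simp add: g_def Legendre_cong)
  qed
  have bd: "\<bar>g x\<bar> \<le> 1" for x
    using Legendre_cases[of "x + a" p] Legendre_cases[of "x + a'" p'] by (auto simp: g_def)
  obtain c where c: "Legendre c (int p) = -1" using exists_nonresidue[OF p] .
  have cop: "coprime (int p) (int p')" using p p' by (simp add: primes_coprime)
  obtain w where w: "[w = c] (mod p)" "[w = 1] (mod p')"
    using binary_chinese_remainder_int[OF cop] by blast
  \<comment> \<open>The shift \<open>(c - 1) * a\<close> is what makes \<open>w * x + v + a\<close>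
    congruent to \<open>c * (x + a)\<close> modulo \<open>p\<close>.\<close>
  obtain v where v: "[v = (c - 1) * a] (mod p)" "[v = 0] (mod p')"
    using binary_chinese_remainder_int[OF cop] by blast
  have copw: "coprime w m"
  proof -
    have "coprime w (int p')" using w(2) by (metis cong_imp_coprime coprime_1_left cong_sym)
    moreover have "coprime w (int p)"
    proof -
      have "\<not> int p dvd c" using c Legendre_eq_0_iff[of c p] by simp
      then have "\<not> int p dvd w" using w(1) cong_dvd_iff by blast
      then show ?thesis using p(1) by (subst coprime_commute) (simp add: prime_imp_coprime)
    qed
    ultimately show ?thesis by (simp add: m_def)
  qed
  have neg: "g (w * x + v) = - g x" for x
  proof -
    have "[w * x + v + a = c * x + (c - 1) * a + a] (mod p)"
      using w v by (intro cong_add cong_mult) auto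
    also have "c * x + (c - 1) * a + a = c * (x + a)" by (simp add: algebra_simps)
    finally have "Legendre (w * x + v + a) p = - Legendre (x + a) p"
      using Legendre_cong Legendre_mult[OF p] c by simp
    moreover have "[w * x + v + a' = 1 * x + 0 + a'] (mod p')"
      using w v by (intro cong_add cong_mult) auto
    then have "Legendre (w * x + v + a') p' = Legendre (x + a') p'"
      using Legendre_cong by simp
    ultimately show ?thesis by (simp add: g_def)
  qed
  have "(\<Sum>x\<in>{0..<m}. g x) = (\<Sum>x\<in>{0..<m}. g (w * x + v))"
    using sum_periodic_affine[of g m w v] per m copw by simp
  also have "\<dots> = - (\<Sum>x\<in>{0..<m}. g x)" by (simp add: neg sum_negf)
  finally have "(\<Sum>x\<in>{0..<m}. g x) = 0" by simp
  from sum_periodic_incomplete[of g m, OF per m this bd, of l u] show ?thesis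
    by (simp add: g_def m_def)
qed

section \<open>Bilinear sums over lattice points\<close>

text \<open>Collects what the bilinear estimate needs from a set of lattice points: linear growth in
  the norm, few rows, and rows that are intervals, so that incomplete character sums apply. It is
  instantiated with the positive integers and with fundamental domains of both quadratic
  rings.\<close>

locale norm_region =
  fixes Z :: "(int \<times> int) set" and N :: "int \<times> int \<Rightarrow> int"
  assumes finite_norm_le: "\<And>B::real. B \<ge> 1 \<Longrightarrow> finite {z \<in> Z. N z \<le> B}"
    and card_norm_le: "\<And>B::real. B \<ge> 1 \<Longrightarrow> card {z \<in> Z. N z \<le> B} \<le> 9 * B"
    and snd_norm_le: "\<And>B::real. \<And>x y. B \<ge> 1 \<Longrightarrow> (x, y) \<in> Z \<Longrightarrow> N (x, y) \<le> B \<Longrightarrow> \<bar>y\<bar> \<le> sqrt B"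
    and slice: "\<And>B::real. \<And>y. B \<ge> 1 \<Longrightarrow> \<exists>l u. {x. (x, y) \<in> Z \<and> N (x, y) \<le> B} = {l..u}"
begin

text \<open>Summing row by row: there are at most \<open>2 * sqrt B + 1\<close> values of
  \<open>y\<close>, and on each row \<open>c * y\<close> and \<open>c' * y\<close> are constant
  shifts.\<close>

lemma Legendre_pair_region_sum:
  fixes p p' :: nat and B :: real
  assumes p: "prime p" "2 < p" and p': "prime p'" "p \<noteq> p'" and B: "B \<ge> 1"
  shows "\<bar>\<Sum>z | z \<in> Z \<and> N z \<le> B. real_of_int (Legendre (fst z + c * snd z) p * Legendre (fst z + c' * snd z) p')\<bar>
    \<le> 3 * sqrt B * (real p * real p')"
proof -
  define h where "h = (\<lambda>x y. real_of_int (Legendre (x + c * y) p * Legendre (x + c' * y) p'))"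
  define Y where "Y = {- \<lfloor>sqrt B\<rfloor>..\<lfloor>sqrt B\<rfloor>}"
  define S where "S = (\<lambda>y. {x. (x, y) \<in> Z \<and> N (x, y) \<le> B})"
  have finS: "finite (S y)" for y using slice[OF B, of y] by (auto simp: S_def)
  have Y: "y \<in> Y" if "(x, y) \<in> Z" "N (x, y) \<le> B" for x y
  proof -
    have "\<bar>y\<bar> \<le> \<lfloor>sqrt B\<rfloor>" using snd_norm_le[OF B that] by (simp add: le_floor_iff)
    then show ?thesis by (auto simp: Y_def)
  qed
  have "(\<Sum>z | z \<in> Z \<and> N z \<le> B. h (fst z) (snd z)) = (\<Sum>(y, x)\<in>(SIGMA y:Y. S y). h x y)"
    by (rule sum.reindex_bij_witness[of _ prod.swap prod.swap]) (auto simp: S_def intro: Y)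
  also have "\<dots> = (\<Sum>y\<in>Y. \<Sum>x\<in>S y. h x y)"
    using finS by (subst sum.Sigma) (auto simp: Y_def)
  also have "\<bar>\<dots>\<bar> \<le> (\<Sum>y\<in>Y. \<bar>\<Sum>x\<in>S y. h x y\<bar>)" by (rule sum_abs)
  also have "\<dots> \<le> (\<Sum>y\<in>Y. real p * real p')"
  proof (rule sum_mono)
    fix y
    obtain l u where "S y = {l..u}" using slice[OF B, of y] unfolding S_def by blast
    then show "\<bar>\<Sum>x\<in>S y. h x y\<bar> \<le> real p * real p'"
      using Legendre_pair_sum[OF p p', of "c * y" "c' * y" l u] by (simp add: h_def)
  qed
  also have "\<dots> = real (card Y) * (real p * real p')" by simp
  also have "\<dots> \<le> 3 * sqrt B * (real p * real p')"
  proof (rule mult_right_mono)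
    have s: "sqrt B \<ge> 1" using B by simp
    then have "real (card Y) = 2 * of_int \<lfloor>sqrt B\<rfloor> + 1" by (simp add: Y_def)
    then show "real (card Y) \<le> 3 * sqrt B" using s by linarith
  qed simp
  finally show ?thesis by (simp add: h_def)
qed

lemma bilinear_bound:
  fixes P Q :: "nat set" and A :: "nat \<Rightarrow> real" and c :: "nat \<Rightarrow> int" and \<zeta> :: "nat \<Rightarrow> int \<times> int"
    and X P0 P1 :: real
  assumes "finite Q" and "P0 \<ge> 1" "P0 \<le> P1" "P1 \<le> X"
    and P: "\<And>p. p \<in> P \<Longrightarrow> prime p \<and> 2 < p \<and> P0 < real p \<and> real p \<le> P1"
    and A: "\<And>p. p \<in> P \<Longrightarrow> \<bar>A p\<bar> \<le> 1"
    and \<zeta>: "\<And>q. q \<in> Q \<Longrightarrow> \<zeta> q \<in> Z \<and> N (\<zeta> q) = int q"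
  shows "(\<Sum>q\<in>Q. \<bar>\<Sum>p | p \<in> P \<and> real (p * q) \<le> X.
            A p * real_of_int (Legendre (fst (\<zeta> q) + c p * snd (\<zeta> q)) p)\<bar>)\<^sup>2
    \<le> 9 * X / P0 * (9 * X * (1 + ln P1) + 3 * P1 ^ 4 * sqrt X)"
proof -
  define \<chi> where "\<chi> = (\<lambda>p z. real_of_int (Legendre (fst z + c p * snd z) (int p)))"
  define R where "R = (\<lambda>B::real. {z \<in> Z. N z \<le> B})"
  \<comment> \<open>The condition on the product is kept inside the sum and expressed by the norm,
    so that \<open>T\<close> makes sense at every lattice point and not only at the points
    \<open>\<zeta> q\<close>.\<close>
  define T where "T = (\<lambda>z. \<Sum>p\<in>P. if real p * N z \<le> X then A p * \<chi> p z else 0)"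
  define P' where "P' = nat \<lfloor>P1\<rfloor>"
  have P1: "P1 \<ge> 1" "X \<ge> 1" "X > 0" "P0 > 0" using assms by linarith+
  have Psub: "P \<subseteq> {1..P'}"
  proof
    fix p assume "p \<in> P"
    then have "1 \<le> p" "real p \<le> P1" using P by force+
    then show "p \<in> {1..P'}" by (simp add: P'_def le_nat_floor)
  qed
  then have finP: "finite P" using finite_subset by blast
  have P': "P' \<ge> 1" "real P' \<le> P1" using P1 by (simp_all add: P'_def le_nat_floor)
  have cardP: "real (card P) \<le> P1"
  proof -
    have "card P \<le> P'" using card_mono[OF _ Psub] by simp
    then show ?thesis using P' by linarith
  qed
  have Xp: "X / real p \<ge> 1" "real p > 0" if "p \<in> P" for p
    using P[OF that] assms by (auto simp: field_simps)
  have \<chi>1: "\<bar>\<chi> p z\<bar> \<le> 1" for p z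
    using Legendre_cases[of "fst z + c p * snd z" p] by (auto simp: \<chi>_def)
  have XP0: "X / P0 \<ge> 1" using assms P1 by (simp add: field_simps)
  have finR: "finite (R B)" "card (R B) \<le> 9 * B" if "B \<ge> 1" for B :: real
    using finite_norm_le[OF that] card_norm_le[OF that] by (simp_all add: R_def)
  have inner: "(\<Sum>p | p \<in> P \<and> real (p * q) \<le> X. A p * \<chi> p (\<zeta> q)) = T (\<zeta> q)" if "q \<in> Q" for q
    using \<zeta>[OF that] finP by (simp add: T_def sum.inter_filter)
  \<comment> \<open>As every \<open>p\<close> exceeds \<open>P0\<close>, no \<open>p\<close> is
    admissible once \<open>q\<close> exceeds \<open>X / P0\<close>; this is where the factor
    \<open>1 / P0\<close> is gained.\<close>
  have T0: "T (\<zeta> q) = 0" if "q \<in> Q" "real q > X / P0" for q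
    unfolding T_def
  proof (intro sum.neutral ballI)
    fix p assume "p \<in> P"
    then have "real p * real q > P0 * (X / P0)" using P[of p] that XP0 P1 by (intro mult_strict_mono) auto
    then show "(if real p * N (\<zeta> q) \<le> X then A p * \<chi> p (\<zeta> q) else 0) = 0"
      using \<zeta>[OF that(1)] P1 by simp
  qed
  have inj: "inj_on \<zeta> Q" using \<zeta> by (metis inj_onI of_nat_eq_iff)
  have "(\<Sum>q\<in>Q. \<bar>T (\<zeta> q)\<bar>) = (\<Sum>q | q \<in> Q \<and> real q \<le> X / P0. \<bar>T (\<zeta> q)\<bar>)"
    using T0 assms(1) by (intro sum.mono_neutral_right) (auto simp: not_le)
  also have "\<dots> = (\<Sum>z\<in>\<zeta> ` {q. q \<in> Q \<and> real q \<le> X / P0}. \<bar>T z\<bar>)"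
    using inj by (subst sum.reindex) (auto simp: inj_on_def)
  \<comment> \<open>Here primality of \<open>q\<close> is given up: the terms are nonnegative, and
    distinct \<open>q\<close> have distinct points because the norm recovers
    \<open>q\<close>.\<close>
  also have "\<dots> \<le> (\<Sum>z\<in>R (X / P0). \<bar>T z\<bar>)"
    using finR(1)[OF XP0] \<zeta> by (intro sum_mono2) (auto simp: R_def)
  finally have S1: "(\<Sum>q\<in>Q. \<bar>T (\<zeta> q)\<bar>) \<le> (\<Sum>z\<in>R (X / P0). \<bar>T z\<bar>)" .
  have CS: "(\<Sum>z\<in>R (X / P0). \<bar>T z\<bar>)\<^sup>2 \<le> card (R (X / P0)) * (\<Sum>z\<in>R (X / P0). (T z)\<^sup>2)"
    using Cauchy_Schwarz_ineq_sum[of "\<lambda>z. \<bar>T z\<bar>" "\<lambda>_. 1" "R (X / P0)"] by (simp add: mult.commute)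
  \<comment> \<open>The two conditions on \<open>N z\<close> combine to a bound by
    \<open>X / max p p'\<close>. Equal primes are handled by counting points, distinct ones by
    cancellation; the second term is granted to both cases so that one formula serves all
    pairs.\<close>
  have off: "\<bar>A p * A p' * (\<Sum>z\<in>R (X / max (real p) (real p')). \<chi> p z * \<chi> p' z)\<bar>
      \<le> (if p = p' then 9 * X / real p else 0) + 3 * sqrt X * P1\<^sup>2"
    if pp: "p \<in> P" "p' \<in> P" for p p'
  proof -
    let ?B = "X / max (real p) (real p')"
    have B: "?B \<ge> 1" "?B \<le> X" using Xp pp P[of p] P[of p'] P1 by (auto simp: max_def field_simps)
    have "\<bar>A p * A p'\<bar> \<le> 1"
      using mult_mono[OF A[OF pp(1)] A[OF pp(2)]] by (simp add: abs_mult)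
    then have "\<bar>A p * A p' * (\<Sum>z\<in>R ?B. \<chi> p z * \<chi> p' z)\<bar> \<le> \<bar>\<Sum>z\<in>R ?B. \<chi> p z * \<chi> p' z\<bar>"
      unfolding abs_mult[of "A p * A p'"] by (intro mult_left_le_one_le) auto
    also have "\<dots> \<le> (if p = p' then 9 * X / real p else 0) + 3 * sqrt X * P1\<^sup>2"
    proof (cases "p = p'")
      case True
      have "\<bar>\<Sum>z\<in>R ?B. \<chi> p z * \<chi> p' z\<bar> \<le> (\<Sum>z\<in>R ?B. \<bar>\<chi> p z * \<chi> p' z\<bar>)" by (rule sum_abs)
      also have "\<dots> \<le> (\<Sum>z\<in>R ?B. 1)"
        using mult_mono[OF \<chi>1 \<chi>1] by (intro sum_mono) (simp add: abs_mult)
      also have "\<dots> \<le> 9 * ?B" using finR(2)[OF B(1)] by simp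
      also have "\<dots> = 9 * X / real p" using True by simp
      also have "\<dots> \<le> 9 * X / real p + 3 * sqrt X * P1\<^sup>2" using P1 by simp
      finally show ?thesis using True by simp
    next
      case False
      have "\<bar>\<Sum>z\<in>R ?B. \<chi> p z * \<chi> p' z\<bar> \<le> 3 * sqrt ?B * (real p * real p')"
        using Legendre_pair_region_sum[of p p' ?B "c p" "c p'"] P[of p] P[of p'] pp False B
        by (simp add: R_def \<chi>_def)
      also have "\<dots> \<le> 3 * sqrt X * (P1 * P1)"
        using B P[of p] P[of p'] pp P1 by (intro mult_mono) auto
      finally show ?thesis using False by (simp add: power2_eq_square)
    qed
    finally show ?thesis .
  qed
  have "(\<Sum>z\<in>R (X / P0). (T z)\<^sup>2)
      = (\<Sum>z\<in>R (X / P0). \<Sum>p\<in>P. \<Sum>p'\<in>P.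
           if real p * N z \<le> X \<and> real p' * N z \<le> X then A p * A p' * (\<chi> p z * \<chi> p' z) else 0)"
    unfolding T_def power2_eq_square sum_product
    by (intro sum.cong refl) auto
  also have "\<dots> = (\<Sum>p\<in>P. \<Sum>p'\<in>P. \<Sum>z\<in>R (X / P0).
           if real p * N z \<le> X \<and> real p' * N z \<le> X then A p * A p' * (\<chi> p z * \<chi> p' z) else 0)"
    by (subst sum.swap, intro sum.cong refl, rule sum.swap)
  also have "\<dots> = (\<Sum>p\<in>P. \<Sum>p'\<in>P. A p * A p' * (\<Sum>z\<in>R (X / max (real p) (real p')). \<chi> p z * \<chi> p' z))"
  proof (intro sum.cong refl)
    fix p p' assume pp: "p \<in> P" "p' \<in> P"
    have "X / max (real p) (real p') = min (X / real p) (X / real p')"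
      using Xp(2)[OF pp(1)] Xp(2)[OF pp(2)] P1 by (auto simp: max_def min_def field_simps)
    then have iff: "real p * N z \<le> X \<and> real p' * N z \<le> X \<longleftrightarrow> N z \<le> X / max (real p) (real p')" for z
      using Xp(2)[OF pp(1)] Xp(2)[OF pp(2)] by (simp add: pos_le_divide_eq mult.commute)
    have le: "X / max (real p) (real p') \<le> X / P0"
      using P[OF pp(1)] P1 by (intro divide_left_mono) auto
    have "{z \<in> R (X / P0). real p * N z \<le> X \<and> real p' * N z \<le> X} = R (X / max (real p) (real p'))"
      using iff le by (auto simp: R_def)
    then show "(\<Sum>z\<in>R (X / P0). if real p * N z \<le> X \<and> real p' * N z \<le> X then A p * A p' * (\<chi> p z * \<chi> p' z) else 0)
       = A p * A p' * (\<Sum>z\<in>R (X / max (real p) (real p')). \<chi> p z * \<chi> p' z)"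
      using finR(1)[OF XP0] by (simp flip: sum.inter_filter add: sum_distrib_left)
  qed
  also have "\<dots> \<le> (\<Sum>p\<in>P. \<Sum>p'\<in>P. (if p = p' then 9 * X / real p else 0) + 3 * sqrt X * P1\<^sup>2)"
    using off by (intro sum_mono) (meson abs_le_D1)
  also have "\<dots> = 9 * X * (\<Sum>p\<in>P. 1 / real p) + (real (card P))\<^sup>2 * (3 * sqrt X * P1\<^sup>2)"
    using finP by (simp add: sum.distrib sum_distrib_left power2_eq_square)
  \<comment> \<open>Both \<open>card P\<close> and the sum of \<open>1 / p\<close> are bounded by
    forgetting that the \<open>p\<close> are primes. The lost logarithm is harmless, as
    \<open>P0\<close> will be a larger power of it.\<close>
  also have "\<dots> \<le> 9 * X * (1 + ln P1) + P1\<^sup>2 * (3 * sqrt X * P1\<^sup>2)"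
  proof (intro add_mono mult_left_mono mult_right_mono power_mono cardP)
    have "(\<Sum>p\<in>P. 1 / real p) \<le> (\<Sum>p=1..P'. 1 / real p)" using Psub by (intro sum_mono2) auto
    also have "\<dots> \<le> 1 + ln (real P')" using P' by (intro sum_inverse_le_ln)
    also have "\<dots> \<le> 1 + ln P1" using P' P1 by simp
    finally show "(\<Sum>p\<in>P. 1 / real p) \<le> 1 + ln P1" .
  qed (use P1 in auto)
  also have "\<dots> = 9 * X * (1 + ln P1) + 3 * P1 ^ 4 * sqrt X"
    by (simp add: power2_eq_square power4_eq_xxxx)
  finally have main: "(\<Sum>z\<in>R (X / P0). (T z)\<^sup>2) \<le> 9 * X * (1 + ln P1) + 3 * P1 ^ 4 * sqrt X" .
  have "(\<Sum>q\<in>Q. \<bar>\<Sum>p | p \<in> P \<and> real (p * q) \<le> X. A p * \<chi> p (\<zeta> q)\<bar>)\<^sup>2 = (\<Sum>q\<in>Q. \<bar>T (\<zeta> q)\<bar>)\<^sup>2"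
    using inner by simp
  also have "\<dots> \<le> (\<Sum>z\<in>R (X / P0). \<bar>T z\<bar>)\<^sup>2" using S1 by (intro power_mono sum_nonneg) auto
  also have "\<dots> \<le> card (R (X / P0)) * (\<Sum>z\<in>R (X / P0). (T z)\<^sup>2)" by (rule CS)
  also have "\<dots> \<le> (9 * (X / P0)) * (9 * X * (1 + ln P1) + 3 * P1 ^ 4 * sqrt X)"
    using finR(2)[OF XP0] main XP0 by (intro mult_mono sum_nonneg) auto
  finally show ?thesis by (simp add: \<chi>_def)
qed

end

section \<open>The estimate for sums over pairs of primes\<close>

text \<open>The terms come from small \<open>p\<close>, of order X ln ln ln X / ln X; from large
  \<open>p\<close>, of order X / ln X; from pairs with both primes at most X^(1/10); and from the
  bilinear sum, of order X / (ln X)^(3/2), since X^(4/10) times \<open>sqrt X\<close> is only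
  X^(9/10).\<close>

lemma smallo_main_terms:
  "(\<lambda>X::real. 16 * X / ln X * (3 + 2 * ln (log 2 ((ln X) ^ 4) + 1)) + 16 * X / ln X * 14
      + (X powr (1/10))\<^sup>2
      + sqrt (9 * X / (ln X) ^ 4 * (9 * X * (1 + ln (X powr (1/10))) + 3 * (X powr (1/10)) ^ 4 * sqrt X)))
    \<in> o(\<lambda>X. X * ln (ln X) / ln X)"
  by real_asymp

text \<open>The hypotheses express a separation of variables: apart from the coefficient
  \<open>A p\<close>, the two primes interact only through a Legendre symbol modulo \<open>p\<close>
  that is linear in the lattice point attached to \<open>q\<close>. Side conditions on the primes
  are encoded in \<open>P\<close> and \<open>Q\<close>.\<close>

theorem (in norm_region) prime_pair_sum_smallo:
  fixes P Q :: "nat set" and A :: "nat \<Rightarrow> real" and c :: "nat \<Rightarrow> int" and \<zeta> :: "nat \<Rightarrow> int \<times> int"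
    and F :: "nat \<Rightarrow> nat \<Rightarrow> real"
  assumes P: "\<And>p. p \<in> P \<Longrightarrow> prime p \<and> 2 < p \<and> \<bar>A p\<bar> \<le> 1"
    and \<zeta>: "\<And>q. q \<in> Q \<Longrightarrow> prime q \<and> \<zeta> q \<in> Z \<and> N (\<zeta> q) = int q"
    and F: "\<And>p q. p \<in> P \<Longrightarrow> q \<in> Q \<Longrightarrow> p < q \<Longrightarrow>
              F p q = A p * real_of_int (Legendre (fst (\<zeta> q) + c p * snd (\<zeta> q)) p)"
    and F0: "\<And>p q. prime p \<Longrightarrow> prime q \<Longrightarrow> \<not> (p \<in> P \<and> q \<in> Q) \<Longrightarrow> F p q = 0"
  shows "(\<lambda>X::real. \<Sum>(p, q) \<in> {(p, q). prime p \<and> prime q \<and> p < q \<and> real (p * q) \<le> X}. F p q)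
    \<in> o[at_top](\<lambda>X. X * ln (ln X) / ln X)"
proof (rule landau_o.big_small_trans[OF _ smallo_main_terms], rule landau_o.bigI[of 1])
  \<comment> \<open>The conditions serve, in order, the reciprocal sum over the large
    \<open>p\<close>, the reciprocal sum over the small \<open>p\<close>, and the inequality
    \<open>P0 \<le> P1\<close>.\<close>
  have ev: "\<forall>\<^sub>F X::real in at_top. X \<ge> 2 ^ 20 \<and> 2 \<le> (ln X) ^ 4 \<and> (ln X) ^ 4 \<le> X powr (1/10)"
    by (intro eventually_conj; real_asymp)
  have *: "\<bar>\<Sum>(p, q) \<in> {(p, q). prime p \<and> prime q \<and> p < q \<and> real (p * q) \<le> X}. F p q\<bar>
    \<le> 16 * X / ln X * (3 + 2 * ln (log 2 ((ln X) ^ 4) + 1)) + 16 * X / ln X * 14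
      + (X powr (1/10))\<^sup>2
      + sqrt (9 * X / (ln X) ^ 4 * (9 * X * (1 + ln (X powr (1/10))) + 3 * (X powr (1/10)) ^ 4 * sqrt X))"
    if X: "X \<ge> 2 ^ 20 \<and> 2 \<le> (ln X) ^ 4 \<and> (ln X) ^ 4 \<le> X powr (1/10)" for X :: real
  proof -
    define P0 where "P0 = (ln X) ^ 4"
    define P1 where "P1 = X powr (1/10)"
    have X1: "X \<ge> 4" using X by simp
    have P01: "2 \<le> P0" "P0 \<le> P1" using X by (simp_all add: P0_def P1_def)
    have "P1 \<le> X powr (1/2)" unfolding P1_def using X1 by (intro powr_mono) auto
    then have P1X: "P1 \<le> sqrt X" using X1 by (simp add: powr_half_sqrt)
    have "sqrt X * 1 \<le> sqrt X * sqrt X" using X1 by (intro mult_left_mono) auto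
    then have sX: "sqrt X \<le> X" using X1 by simp
    define D where "D = {(p::nat, q::nat). prime p \<and> prime q \<and> p < q \<and> real (p * q) \<le> X}"
    have ple: "real p \<le> sqrt X" if "(p, q) \<in> D" for p q
    proof -
      have "p * p \<le> p * q" using that by (simp add: D_def)
      then have "real (p * p) \<le> X" using that unfolding D_def by (smt (verit) case_prodD mem_Collect_eq of_nat_le_iff)
      then show ?thesis by (intro real_le_rsqrt) (simp add: power2_eq_square)
    qed
    have qle: "real q \<le> X" if "(p, q) \<in> D" for p q
    proof -
      have "1 * q \<le> p * q" using that by (intro mult_le_mono) (auto simp: D_def prime_ge_Suc_0_nat)
      then show ?thesis using that unfolding D_def by (smt (verit) case_prodD mem_Collect_eq of_nat_le_iff mult_1)
    qed
    have "D \<subseteq> {..nat \<lfloor>X\<rfloor>} \<times> {..nat \<lfloor>X\<rfloor>}"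
    proof
      fix z assume z: "z \<in> D"
      obtain p q where "z = (p, q)" by fastforce
      then show "z \<in> {..nat \<lfloor>X\<rfloor>} \<times> {..nat \<lfloor>X\<rfloor>}"
        using z ple[of p q] qle[of p q] sX by (auto intro!: le_nat_floor)
    qed
    then have finD: "finite D" by (rule finite_subset) auto
    define D1 where "D1 = {(p, q). (p, q) \<in> D \<and> real p \<le> P0}"
    define D2 where "D2 = {(p, q). (p, q) \<in> D \<and> P1 < real p}"
    \<comment> \<open>Discarding these pairs leaves \<open>p \<le> P1 < q\<close> in
      \<open>D4\<close>. There \<open>p < q\<close> is automatic and no longer couples the two
      variables.\<close>
    define D3 where "D3 = {(p, q). (p, q) \<in> D \<and> real p \<le> P1 \<and> real q \<le> P1}"
    define D4 where "D4 = {(p, q). (p, q) \<in> D \<and> P0 < real p \<and> real p \<le> P1 \<and> P1 < real q}"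
    have F1: "\<bar>F p q\<bar> \<le> 1" if "(p, q) \<in> D" for p q
    proof (cases "p \<in> P \<and> q \<in> Q")
      case True
      let ?L = "Legendre (fst (\<zeta> q) + c p * snd (\<zeta> q)) (int p)"
      have "F p q = A p * real_of_int ?L" using F[of p q] True that by (auto simp: D_def)
      then have "\<bar>F p q\<bar> = \<bar>A p\<bar> * \<bar>real_of_int ?L\<bar>" by (simp add: abs_mult)
      also have "\<dots> \<le> 1 * 1" using P[of p] True Legendre_cases[of "fst (\<zeta> q) + c p * snd (\<zeta> q)" p]
        by (intro mult_mono) auto
      finally show ?thesis by simp
    next
      case False
      then show ?thesis using F0[of p q] that by (auto simp: D_def)
    qed
    let ?F = "\<lambda>(p, q). F p q"
    have trivial: "\<bar>sum ?F E\<bar> \<le> card E" if "E \<subseteq> D" for E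
    proof -
      have "\<bar>sum ?F E\<bar> \<le> (\<Sum>z\<in>E. \<bar>?F z\<bar>)" by (rule sum_abs)
      also have "\<dots> \<le> (\<Sum>z\<in>E. 1)" using F1 that by (intro sum_mono) auto
      finally show ?thesis by simp
    qed
    have split: "\<bar>sum ?F D\<bar> \<le> card D1 + card D2 + card D3 + \<bar>sum ?F D4\<bar>"
    proof -
      have "D = (D - D4) \<union> D4" by (auto simp: D4_def)
      then have "sum ?F D = sum ?F (D - D4) + sum ?F D4"
        using finD by (metis Diff_disjoint Int_commute Un_Diff_cancel2 finite_Diff finite_Un sum.union_disjoint)
      then have "\<bar>sum ?F D\<bar> \<le> \<bar>sum ?F (D - D4)\<bar> + \<bar>sum ?F D4\<bar>" by simp
      also have "\<bar>sum ?F (D - D4)\<bar> \<le> card (D - D4)" by (rule trivial) auto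
      also have "real (card (D - D4)) \<le> card (D1 \<union> D2 \<union> D3)"
        using finD by (intro of_nat_mono card_mono) (auto simp: D1_def D2_def D3_def D4_def intro: finite_subset[OF _ finD])
      also have "\<dots> \<le> card D1 + card D2 + card D3"
        using card_Un_le[of "D1 \<union> D2" D3] card_Un_le[of D1 D2] by linarith
      finally show ?thesis by simp
    qed
    have lnX: "16 * X / ln X \<ge> 0" using X1 by simp
    have c1: "card D1 \<le> 16 * X / ln X * (3 + 2 * ln (log 2 P0 + 1))"
    proof -
      let ?A = "{p. prime p \<and> real p \<le> P0}"
      have fin: "finite ?A"
        by (rule finite_subset[of _ "{..nat \<lfloor>P0\<rfloor>}"]) (auto intro: le_nat_floor)
      have A: "p \<ge> 1 \<and> real p \<le> sqrt X" if "p \<in> ?A" for p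
        using that P01 P1X by (auto simp: prime_ge_Suc_0_nat)
      note pairs = card_prime_pairs_le[OF X1 fin A]
      have "D1 \<subseteq> {(p, q). p \<in> ?A \<and> prime q \<and> real (p * q) \<le> X}" by (auto simp: D1_def D_def)
      then have "card D1 \<le> card {(p, q). p \<in> ?A \<and> prime q \<and> real (p * q) \<le> X}"
        using pairs(1) by (intro card_mono)
      also have "real \<dots> \<le> 16 * X / ln X * (\<Sum>p\<in>?A. 1 / real p)" by (rule pairs(2))
      also have "\<dots> \<le> 16 * X / ln X * (3 + 2 * ln (log 2 P0 + 1))"
        using lnX P01 by (intro mult_left_mono sum_inverse_primes_le)
      finally show ?thesis by simp
    qed
    have c2: "card D2 \<le> 16 * X / ln X * 14"
    proof -
      let ?A = "{p. prime p \<and> P1 < real p \<and> real p \<le> sqrt X}"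
      have fin: "finite ?A"
        by (rule finite_subset[of _ "{..nat \<lfloor>sqrt X\<rfloor>}"]) (auto intro: le_nat_floor)
      have A: "p \<ge> 1 \<and> real p \<le> sqrt X" if "p \<in> ?A" for p
        using that by (auto simp: prime_ge_Suc_0_nat)
      note pairs = card_prime_pairs_le[OF X1 fin A]
      have "D2 \<subseteq> {(p, q). p \<in> ?A \<and> prime q \<and> real (p * q) \<le> X}"
        using ple by (auto simp: D2_def) (auto simp: D_def)
      then have "card D2 \<le> card {(p, q). p \<in> ?A \<and> prime q \<and> real (p * q) \<le> X}"
        using pairs(1) by (intro card_mono)
      also have "real \<dots> \<le> 16 * X / ln X * (\<Sum>p\<in>?A. 1 / real p)" by (rule pairs(2))
      also have "\<dots> \<le> 16 * X / ln X * 14"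
        unfolding P1_def using lnX X by (intro mult_left_mono sum_inverse_primes_root_range) auto
      finally show ?thesis by simp
    qed
    have c3: "card D3 \<le> P1\<^sup>2"
    proof -
      define n where "n = nat \<lfloor>P1\<rfloor>"
      have "D3 \<subseteq> {1..n} \<times> {1..n}"
        by (auto simp: D3_def D_def n_def prime_ge_Suc_0_nat intro!: le_nat_floor)
      then have "card D3 \<le> card ({1..n} \<times> {1..n})" by (intro card_mono) auto
      then have "real (card D3) \<le> real (n * n)" by (simp only: card_cartesian_product card_atLeastAtMost of_nat_le_iff) simp
      also have "\<dots> \<le> P1 * P1" unfolding of_nat_mult using P01 by (intro mult_mono) (auto simp: n_def)
      finally show ?thesis by (simp add: power2_eq_square)
    qed
    have c4: "\<bar>sum ?F D4\<bar> \<le> sqrt (9 * X / P0 * (9 * X * (1 + ln P1) + 3 * P1 ^ 4 * sqrt X))"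
    proof -
      define Pf where "Pf = {p \<in> P. P0 < real p \<and> real p \<le> P1}"
      define Qf where "Qf = {q \<in> Q. P1 < real q \<and> real q \<le> X}"
      define h where "h = (\<lambda>p q. A p * real_of_int (Legendre (fst (\<zeta> q) + c p * snd (\<zeta> q)) (int p)))"
      have finQ: "finite Qf"
        by (rule finite_subset[of _ "{..nat \<lfloor>X\<rfloor>}"]) (auto simp: Qf_def intro: le_nat_floor)
      have finP: "finite Pf"
        by (rule finite_subset[of _ "{..nat \<lfloor>P1\<rfloor>}"]) (auto simp: Pf_def intro: le_nat_floor)
      have fin4: "finite D4" by (rule finite_subset[OF _ finD]) (auto simp: D4_def)
      have "sum ?F D4 = sum ?F {(p, q) \<in> D4. p \<in> P \<and> q \<in> Q}"
        using fin4 F0 by (intro sum.mono_neutral_right) (auto simp: D4_def D_def)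
      also have "\<dots> = (\<Sum>(q, p)\<in>(SIGMA q:Qf. {p. p \<in> Pf \<and> real (p * q) \<le> X}). h p q)"
      proof (rule sum.reindex_bij_witness[of _ prod.swap prod.swap])
        fix z assume "z \<in> {(p, q) \<in> D4. p \<in> P \<and> q \<in> Q}"
        then show "prod.swap z \<in> (SIGMA q:Qf. {p. p \<in> Pf \<and> real (p * q) \<le> X})"
          using qle by (auto simp: D4_def Pf_def Qf_def) (auto simp: D_def)
      next
        fix z assume "z \<in> (SIGMA q:Qf. {p. p \<in> Pf \<and> real (p * q) \<le> X})"
        then show "prod.swap z \<in> {(p, q) \<in> D4. p \<in> P \<and> q \<in> Q}"
          using P \<zeta> by (auto simp: D4_def D_def Pf_def Qf_def)
      qed (auto simp: h_def D4_def D_def F)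
      also have "\<dots> = (\<Sum>q\<in>Qf. \<Sum>p | p \<in> Pf \<and> real (p * q) \<le> X. h p q)"
        using finQ finP by (subst sum.Sigma) auto
      also have "\<bar>\<dots>\<bar> \<le> (\<Sum>q\<in>Qf. \<bar>\<Sum>p | p \<in> Pf \<and> real (p * q) \<le> X. h p q\<bar>)" by (rule sum_abs)
      also have "\<dots> \<le> sqrt (9 * X / P0 * (9 * X * (1 + ln P1) + 3 * P1 ^ 4 * sqrt X))"
        unfolding h_def
        using P01 P1X sX P \<zeta> by (intro real_le_rsqrt bilinear_bound finQ) (auto simp: Pf_def Qf_def)
      finally show ?thesis .
    qed
    show ?thesis using split c1 c2 c3 c4 unfolding P0_def P1_def D_def by linarith
  qed
  show "\<forall>\<^sub>F X in at_top. norm (\<Sum>(p, q) \<in> {(p, q). prime p \<and> prime q \<and> p < q \<and> real (p * q) \<le> X}. F p q)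
    \<le> 1 * norm (16 * X / ln X * (3 + 2 * ln (log 2 ((ln X) ^ 4) + 1)) + 16 * X / ln X * 14
      + (X powr (1/10))\<^sup>2
      + sqrt (9 * X / (ln X) ^ 4 * (9 * X * (1 + ln (X powr (1/10))) + 3 * (X powr (1/10)) ^ 4 * sqrt X)))"
    using ev
  proof eventually_elim
    case (elim X)
    from *[OF elim] show ?case by (simp only: real_norm_def mult_1 abs_ge_self order_trans[OF _ abs_ge_self])
  qed
qed simp

section \<open>Fundamental domains\<close>

text \<open>The degenerate region for the exponent \<open>e2 = 0\<close>: the positive integers as a
  single row, with the integer itself as its norm.\<close>

lemma norm_region_nat: "norm_region {(x, y). y = 0 \<and> 1 \<le> x} fst"
proof
  fix B :: real assume B: "B \<ge> 1"
  let ?Z = "{(x, y). y = 0 \<and> 1 \<le> x} :: (int \<times> int) set"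
  have eq: "{z \<in> ?Z. real_of_int (fst z) \<le> B} = (\<lambda>x. (x, 0)) ` {1..\<lfloor>B\<rfloor>}"
    by (auto simp: le_floor_iff)
  show "finite {z \<in> ?Z. real_of_int (fst z) \<le> B}" unfolding eq by simp
  have "card ((\<lambda>x::int. (x, 0::int)) ` {1..\<lfloor>B\<rfloor>}) = card {1..\<lfloor>B\<rfloor>}"
    by (rule card_image) (simp add: inj_on_def)
  then have "real (card ((\<lambda>x::int. (x, 0::int)) ` {1..\<lfloor>B\<rfloor>})) = of_int \<lfloor>B\<rfloor>" using B by simp
  also have "\<dots> \<le> 9 * B" using B by linarith
  finally show "real (card {z \<in> ?Z. real_of_int (fst z) \<le> B}) \<le> 9 * B"
    unfolding eq .
  show "\<exists>l u. {x. (x, y) \<in> ?Z \<and> real_of_int (fst (x, y)) \<le> B} = {l..u}" for y :: int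
  proof (cases "y = 0")
    case True
    have "{x. (x, y) \<in> ?Z \<and> real_of_int (fst (x, y)) \<le> B} = {1..\<lfloor>B\<rfloor>}"
      using True by (auto simp: le_floor_iff)
    then show ?thesis by blast
  next
    case False
    then have "{x. (x, y) \<in> ?Z \<and> real_of_int (fst (x, y)) \<le> B} = {1..0}" by auto
    then show ?thesis by blast
  qed
qed auto

text \<open>For negative \<open>C\<close> both sides are false, because \<open>sqrt\<close> is an
  odd function here.\<close>

lemma le_sqrt_iff_square_le:
  assumes "0 \<le> x"
  shows "x \<le> sqrt C \<longleftrightarrow> x\<^sup>2 \<le> C"
  using real_sqrt_le_iff[of "x\<^sup>2" C] assms by simp

text \<open>The hypothesis \<open>box\<close> confines the points to a rectangle with sides
  proportional to \<open>sqrt B\<close>, which gives finiteness and the count. A row is an interval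
  because on nonnegative \<open>x\<close> the norm condition is an upper bound for
  \<open>x\<close>.\<close>

lemma norm_regionI:
  fixes lo :: "int \<Rightarrow> int" and k :: int
  assumes lo: "\<And>y. lo y \<ge> 0"
    and box: "\<And>B::real. \<And>x y. lo y \<le> x \<Longrightarrow> real_of_int (x\<^sup>2 + k * y\<^sup>2) \<le> B \<Longrightarrow>
           real_of_int (x\<^sup>2) \<le> 4 * B \<and> real_of_int (y\<^sup>2) \<le> B"
  shows "norm_region {(x, y). lo y \<le> x} (\<lambda>(x, y). x\<^sup>2 + k * y\<^sup>2)"
proof
  fix B :: real assume B: "B \<ge> 1"
  let ?R = "{z \<in> {(x, y). lo y \<le> x}. real_of_int (case z of (x, y) \<Rightarrow> x\<^sup>2 + k * y\<^sup>2) \<le> B}"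
  have s: "sqrt B \<ge> 1" using B by simp
  have x: "real_of_int x \<le> 2 * sqrt B" and y: "\<bar>real_of_int y\<bar> \<le> sqrt B"
    if "lo y \<le> x" "real_of_int (x\<^sup>2 + k * y\<^sup>2) \<le> B" for x y
  proof -
    have "real_of_int (x\<^sup>2) \<le> 4 * B" "real_of_int (y\<^sup>2) \<le> B" using box[of y x B] that by auto
    moreover have "0 \<le> real_of_int x" using that(1) lo[of y] by simp
    ultimately have "real_of_int x \<le> sqrt (4 * B)" "\<bar>real_of_int y\<bar> \<le> sqrt B"
      by (auto simp: le_sqrt_iff_square_le)
    then show "real_of_int x \<le> 2 * sqrt B" "\<bar>real_of_int y\<bar> \<le> sqrt B"
      by (simp_all add: real_sqrt_mult)
  qed
  have sub: "?R \<subseteq> {0..\<lfloor>2 * sqrt B\<rfloor>} \<times> {- \<lfloor>sqrt B\<rfloor>..\<lfloor>sqrt B\<rfloor>}"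
  proof
    fix z assume z: "z \<in> ?R"
    obtain a b where ab: "z = (a, b)" by fastforce
    then have "0 \<le> a" "real_of_int a \<le> 2 * sqrt B" "\<bar>real_of_int b\<bar> \<le> sqrt B"
      using z x[of b a] y[of b a] order_trans[OF lo[of b]] by auto
    then have "0 \<le> a" "a \<le> \<lfloor>2 * sqrt B\<rfloor>" "\<bar>b\<bar> \<le> \<lfloor>sqrt B\<rfloor>" by (simp_all add: le_floor_iff)
    then show "z \<in> {0..\<lfloor>2 * sqrt B\<rfloor>} \<times> {- \<lfloor>sqrt B\<rfloor>..\<lfloor>sqrt B\<rfloor>}" using ab by auto
  qed
  show "finite ?R" using sub by (rule finite_subset) auto
  have "card ?R \<le> card ({0..\<lfloor>2 * sqrt B\<rfloor>} \<times> {- \<lfloor>sqrt B\<rfloor>..\<lfloor>sqrt B\<rfloor>})"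
    using sub by (intro card_mono) auto
  then have "real (card ?R) \<le> real (card {0..\<lfloor>2 * sqrt B\<rfloor>}) * real (card {- \<lfloor>sqrt B\<rfloor>..\<lfloor>sqrt B\<rfloor>})"
    unfolding of_nat_mult[symmetric] of_nat_le_iff card_cartesian_product .
  also have "\<dots> \<le> (3 * sqrt B) * (3 * sqrt B)"
  proof (rule mult_mono)
    show "real (card {0..\<lfloor>2 * sqrt B\<rfloor>}) \<le> 3 * sqrt B" using s of_int_floor_le[of "2 * sqrt B"]
      by (subst card_atLeastAtMost_int) linarith
    show "real (card {- \<lfloor>sqrt B\<rfloor>..\<lfloor>sqrt B\<rfloor>}) \<le> 3 * sqrt B" using s of_int_floor_le[of "sqrt B"]
      by (subst card_atLeastAtMost_int) linarith
  qed (use s in auto)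
  also have "\<dots> = 9 * B" using B by simp
  finally show "real (card ?R) \<le> 9 * B" .
  show "\<bar>real_of_int y\<bar> \<le> sqrt B"
    if "(x, y) \<in> {(x, y). lo y \<le> x}" "real_of_int (case (x, y) of (x, y) \<Rightarrow> x\<^sup>2 + k * y\<^sup>2) \<le> B" for x y
    using that y[of y x] by simp
  show "\<exists>l u. {x. (x, y) \<in> {(x, y). lo y \<le> x} \<and> real_of_int (case (x, y) of (x, y) \<Rightarrow> x\<^sup>2 + k * y\<^sup>2) \<le> B} = {l..u}"
    for y
  \<comment> \<open>If \<open>B - k * y\<^sup>2\<close> is negative, so is its \<open>sqrt\<close>,
    and the interval is empty, as it should be.\<close>
  proof (intro exI)
    show "{x. (x, y) \<in> {(x, y). lo y \<le> x} \<and> real_of_int (case (x, y) of (x, y) \<Rightarrow> x\<^sup>2 + k * y\<^sup>2) \<le> B}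
      = {lo y..\<lfloor>sqrt (B - k * y\<^sup>2)\<rfloor>}"
    proof (rule Set.set_eqI)
      fix x
      have "real_of_int x \<le> sqrt (B - k * y\<^sup>2) \<longleftrightarrow> (real_of_int x)\<^sup>2 \<le> B - k * y\<^sup>2" if "lo y \<le> x"
        using that lo[of y] by (intro le_sqrt_iff_square_le) auto
      then show "x \<in> {x. (x, y) \<in> {(x, y). lo y \<le> x} \<and> real_of_int (case (x, y) of (x, y) \<Rightarrow> x\<^sup>2 + k * y\<^sup>2) \<le> B}
        \<longleftrightarrow> x \<in> {lo y..\<lfloor>sqrt (B - k * y\<^sup>2)\<rfloor>}"
        by (auto simp: le_floor_iff algebra_simps)
    qed
  qed
qed

text \<open>The half-plane contains a representative of every Gaussian integer up to sign.\<close>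

lemma norm_region_gauss: "norm_region {(x, y). 0 \<le> x} (\<lambda>(x, y). x\<^sup>2 + 1 * y\<^sup>2)"
proof (rule norm_regionI)
  fix B :: real and x y :: int
  assume "real_of_int (x\<^sup>2 + 1 * y\<^sup>2) \<le> B"
  moreover have "0 \<le> real_of_int (x\<^sup>2)" "0 \<le> real_of_int (y\<^sup>2)" by simp_all
  ultimately show "real_of_int (x\<^sup>2) \<le> 4 * B \<and> real_of_int (y\<^sup>2) \<le> B"
    unfolding of_int_add of_int_mult of_int_1 by linarith
qed simp

text \<open>The norm form is indefinite, and infinitely many units preserve it. In the cone
  \<open>2 * \<bar>y\<bar> \<le> x\<close> it is at least half of \<open>x\<^sup>2\<close>, so
  bounded norm again means bounded coordinates.\<close>

lemma norm_region_sqrt2: "norm_region {(x, y). 2 * \<bar>y\<bar> \<le> x} (\<lambda>(x, y). x\<^sup>2 + (-2) * y\<^sup>2)"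
proof (rule norm_regionI)
  fix B :: real and x y :: int
  assume *: "2 * \<bar>y\<bar> \<le> x" "real_of_int (x\<^sup>2 + (-2) * y\<^sup>2) \<le> B"
  have "(2 * \<bar>y\<bar>)\<^sup>2 \<le> x\<^sup>2" using *(1) by (intro power_mono) auto
  then have "4 * y\<^sup>2 \<le> x\<^sup>2" by (simp add: power_mult_distrib)
  then have "real_of_int (4 * y\<^sup>2) \<le> real_of_int (x\<^sup>2)" by (simp only: of_int_le_iff)
  moreover have "0 \<le> real_of_int (y\<^sup>2)" by simp
  ultimately show "real_of_int (x\<^sup>2) \<le> 4 * B \<and> real_of_int (y\<^sup>2) \<le> B"
    using *(2) unfolding of_int_add of_int_mult of_int_minus of_int_numeral by linarith
qed simp

section \<open>Residue symbols in the quadratic ring\<close>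

text \<open>The number \<open>c\<close> is the image of the square root of \<open>\<delta>\<close>
  under reduction modulo an element of norm \<open>p\<close>. It exists since \<open>p\<close>
  cannot divide \<open>b\<close>: it would then divide \<open>a\<close>, and its square would divide
  \<open>p\<close>.\<close>

lemma exists_sqrt_mod_norm:
  fixes p :: nat and a b \<delta> :: int
  assumes "prime p" "a\<^sup>2 - \<delta> * b\<^sup>2 = int p"
  obtains c where "int p dvd a + c * b" "int p dvd c\<^sup>2 - \<delta>"
proof -
  have pr: "prime (int p)" using assms(1) by simp
  have nb: "\<not> int p dvd b"
  proof
    assume b: "int p dvd b"
    then have "int p dvd \<delta> * b\<^sup>2" by (simp add: power2_eq_square)
    then have "int p dvd a\<^sup>2" using assms(2) by (metis dvd_refl diff_add_cancel dvd_add)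
    then have "int p dvd a" using pr prime_dvd_power by blast
    then have "(int p)\<^sup>2 dvd a\<^sup>2" "(int p)\<^sup>2 dvd \<delta> * b\<^sup>2" using b by auto
    then have "(int p)\<^sup>2 dvd int p" using assms(2) by (metis dvd_diff)
    then have "int p * int p \<le> int p" using assms(1) by (intro zdvd_imp_le) (auto simp: power2_eq_square prime_gt_0_nat)
    then show False using assms(1) prime_gt_1_nat[of p] by simp
  qed
  then have "coprime b (int p)" using pr prime_imp_coprime coprime_commute by blast
  then obtain b' where b': "[b * b' = 1] (mod int p)" using cong_solve_coprime_int by blast
  \<comment> \<open>Modulo \<open>p\<close> this choice is forced by the first congruence; the
    second then follows from the norm equation.\<close>
  define c where "c = - a * b'"
  have "a + c * b = a * (1 - b * b')" by (simp add: c_def algebra_simps)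
  moreover have "int p dvd 1 - b * b'" using b' by (metis cong_iff_dvd_diff cong_sym)
  ultimately have c1: "int p dvd a + c * b" by simp
  have "b\<^sup>2 * (c\<^sup>2 - \<delta>) = (c * b + a) * (c * b - a) + int p"
    unfolding assms(2)[symmetric] by (simp add: power2_eq_square algebra_simps)
  moreover have "int p dvd \<dots>" using c1 by (simp add: add.commute)
  ultimately have "int p dvd b\<^sup>2 * (c\<^sup>2 - \<delta>)" by simp
  then have "int p dvd c\<^sup>2 - \<delta>"
    using nb pr prime_dvd_multD prime_dvd_power by blast
  with c1 show ?thesis using that by blast
qed

lemma quad_ring_minus [simp]:
  "(x, y) \<ominus>\<^bsub>quad_ring d\<^esub> (x', y') = (x - x', y - y')"
proof -
  interpret cring "quad_ring d" by (rule cring_quad_ring)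
  have "\<ominus>\<^bsub>quad_ring d\<^esub> (x', y') = (- x', - y')"
    by (rule minus_equality) simp_all
  then show ?thesis by (simp add: a_minus_def)
qed

text \<open>The principal ideal is the kernel of the homomorphism to the integers modulo
  \<open>p\<close> that sends the square root to \<open>c\<close>.\<close>

lemma mem_PIdl_iff:
  fixes p :: nat and a b c d :: int
  assumes "prime p" "quad_norm d (a, b) = int p"
    and c: "int p dvd a + c * b" "int p dvd c\<^sup>2 - d div 4"
  shows "(x, y) \<in> PIdl\<^bsub>quad_ring d\<^esub> (a, b) \<longleftrightarrow> int p dvd x + c * y"
proof
  assume "(x, y) \<in> PIdl\<^bsub>quad_ring d\<^esub> (a, b)"
  then obtain u v where "(x, y) = (u, v) \<otimes>\<^bsub>quad_ring d\<^esub> (a, b)"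
    unfolding cgenideal_def by auto
  then have "x + c * y = (u + c * v) * (a + c * b) - (c\<^sup>2 - d div 4) * (v * b)"
    by (simp add: power2_eq_square algebra_simps)
  then show "int p dvd x + c * y" using c by simp
next
  define \<delta> where "\<delta> = d div 4"
  have n: "a\<^sup>2 - \<delta> * b\<^sup>2 = int p" using assms(2) by (simp add: quad_norm_def \<delta>_def)
  have p0: "int p \<noteq> 0" using assms(1) by auto
  assume xy: "int p dvd x + c * y"
  \<comment> \<open>The numbers \<open>x * a - \<delta> * y * b\<close> and
    \<open>y * a - x * b\<close> are the coordinates of \<open>(x, y)\<close> times the conjugate of
    \<open>(a, b)\<close>. Dividing them by the norm \<open>p\<close> gives the cofactor
    \<open>(u, v)\<close>.\<close>
  have "y * a - x * b = y * (a + c * b) - (x + c * y) * b" by (simp add: algebra_simps)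
  then have 1: "int p dvd y * a - x * b" using c xy by simp
  have "x * a - \<delta> * y * b = (x + c * y) * a - c * y * (a + c * b) + (c\<^sup>2 - \<delta>) * (y * b)"
    by (simp add: power2_eq_square algebra_simps)
  then have 2: "int p dvd x * a - \<delta> * y * b" using c xy by (simp add: \<delta>_def)
  obtain u v where uv: "x * a - \<delta> * y * b = int p * u" "y * a - x * b = int p * v"
    using 1 2 by (auto elim!: dvdE)
  have "int p * (u * a + \<delta> * v * b) = (x * a - \<delta> * y * b) * a + \<delta> * (y * a - x * b) * b"
    unfolding uv by (simp add: algebra_simps)
  also have "\<dots> = x * int p" unfolding n[symmetric] by (simp add: power2_eq_square algebra_simps)
  finally have x: "u * a + \<delta> * v * b = x" using p0 by simp
  have "int p * (u * b + v * a) = (x * a - \<delta> * y * b) * b + (y * a - x * b) * a"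
    unfolding uv by (simp add: algebra_simps)
  also have "\<dots> = y * int p" unfolding n[symmetric] by (simp add: power2_eq_square algebra_simps)
  finally have y: "u * b + v * a = y" using p0 by simp
  have "(x, y) = (u, v) \<otimes>\<^bsub>quad_ring d\<^esub> (a, b)" using x y by (simp add: \<delta>_def)
  then show "(x, y) \<in> PIdl\<^bsub>quad_ring d\<^esub> (a, b)"
    unfolding cgenideal_def by (simp del: quad_ring_simps(2)) blast
qed

text \<open>The residue ring is the field with \<open>p\<close> elements via
  \<open>x + c * y\<close>, and every class contains a rational integer, so squares in the two rings
  correspond.\<close>

lemma quad_symbol_PIdl:
  fixes p :: nat and a b c d :: int
  assumes "prime p" "quad_norm d (a, b) = int p"
    and c: "int p dvd a + c * b" "int p dvd c\<^sup>2 - d div 4"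
  shows "quad_symbol d (x, y) (PIdl\<^bsub>quad_ring d\<^esub> (a, b)) = Legendre (x + c * y) (int p)"
proof -
  note mem = mem_PIdl_iff[OF assms]
  have "(\<exists>s\<in>carrier (quad_ring d). (s \<otimes>\<^bsub>quad_ring d\<^esub> s) \<ominus>\<^bsub>quad_ring d\<^esub> (x, y) \<in> PIdl\<^bsub>quad_ring d\<^esub> (a, b))
      \<longleftrightarrow> (\<exists>u v. int p dvd (u + c * v)\<^sup>2 - (x + c * y))"
  proof -
    have "int p dvd u * u + d div 4 * v * v - x + c * (u * v + v * u - y)
        \<longleftrightarrow> int p dvd (u + c * v)\<^sup>2 - (x + c * y)" for u v
    proof -
      have "(u + c * v)\<^sup>2 - (x + c * y)
          = (u * u + d div 4 * v * v - x + c * (u * v + v * u - y)) + (c\<^sup>2 - d div 4) * (v * v)"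
        by (simp add: power2_eq_square algebra_simps)
      then show ?thesis using c(2) by (metis dvd_add_left_iff dvd_mult2)
    qed
    then show ?thesis by (simp add: mem)
  qed
  also have "\<dots> \<longleftrightarrow> QuadRes (int p) (x + c * y)"
  proof
    assume "\<exists>u v. int p dvd (u + c * v)\<^sup>2 - (x + c * y)"
    then show "QuadRes (int p) (x + c * y)" unfolding QuadRes_def cong_iff_dvd_diff by blast
  next
    assume "QuadRes (int p) (x + c * y)"
    then obtain u where "int p dvd u\<^sup>2 - (x + c * y)" unfolding QuadRes_def cong_iff_dvd_diff by blast
    then show "\<exists>u v. int p dvd (u + c * v)\<^sup>2 - (x + c * y)"
      by (intro exI[of _ u] exI[of _ 0]) simp
  qed
  finally show ?thesis by (simp add: quad_symbol_def Legendre_def mem cong_0_iff)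
qed

text \<open>Conjugation replaces \<open>c\<close> by \<open>- c\<close> in the reduction, and the
  symbol is multiplicative. The first factor depends on \<open>p\<close> alone.\<close>

lemma eps_eq_Legendre:
  fixes p :: nat
  assumes "prime p" "2 < p" "quad_norm d (a, b) = int p"
    and c: "int p dvd a + c * b" "int p dvd c\<^sup>2 - d div 4"
    and "\<pi> p = (a, b)" "\<pi> q = (x, y)"
  shows "eps d \<pi> p q = Legendre (a - c * b) p * Legendre (x - c * y) p"
proof -
  have "eps d \<pi> p q = Legendre (a * x + (d div 4) * b * y + c * (- (a * y + b * x))) p"
    using quad_symbol_PIdl[OF assms(1,3) c] by (simp add: eps_def quad_conj_def assms(6,7))
  also have "\<dots> = Legendre ((a - c * b) * (x - c * y)) p"
  proof (rule Legendre_cong)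
    have "a * x + (d div 4) * b * y + c * (- (a * y + b * x)) - (a - c * b) * (x - c * y)
        = - ((c\<^sup>2 - d div 4) * (b * y))"
      by (simp add: power2_eq_square algebra_simps)
    then show "[a * x + (d div 4) * b * y + c * (- (a * y + b * x)) = (a - c * b) * (x - c * y)] (mod int p)"
      using c(2) by (simp add: cong_iff_dvd_diff)
  qed
  also have "\<dots> = Legendre (a - c * b) p * Legendre (x - c * y) p"
    by (rule Legendre_mult[OF assms(1,2)])
  finally show ?thesis .
qed

lemma Legendre_norm:
  fixes p :: nat
  assumes "prime p" "2 < p" "int p dvd c\<^sup>2 - \<delta>"
  shows "Legendre (x\<^sup>2 - \<delta> * y\<^sup>2) p = Legendre (x + c * y) p * Legendre (x - c * y) p"
proof -
  have "x\<^sup>2 - \<delta> * y\<^sup>2 - (x + c * y) * (x - c * y) = (c\<^sup>2 - \<delta>) * y\<^sup>2"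
    by (simp add: power2_eq_square algebra_simps)
  then have "[x\<^sup>2 - \<delta> * y\<^sup>2 = (x + c * y) * (x - c * y)] (mod int p)"
    using assms(3) by (simp add: cong_iff_dvd_diff)
  then show ?thesis using Legendre_cong Legendre_mult[OF assms(1,2)] by simp
qed

text \<open>Used to move the modulus to the smaller prime, over which no sum is taken when
  periodicity is exploited.\<close>

lemma Legendre_swap:
  fixes p q :: nat
  assumes "prime p" "prime q" "p \<noteq> q" "[p = 1] (mod 4)" "2 < p" "2 < q"
  shows "Legendre p q = Legendre q p"
proof -
  have "p mod 4 = 1" using assms(4) by (simp add: unique_euclidean_semiring_class.cong_def)
  then have "even ((p - 1) div 2)" by presburger
  then have "Legendre p q * Legendre q p = 1"
    using Quadratic_Reciprocity[of p q] assms by simp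
  then show ?thesis using Legendre_cases[of p q] Legendre_cases[of q p] by auto
qed

lemma Legendre_uminus:
  fixes p :: nat
  assumes "prime p" "2 < p" "[p = 1] (mod 4)"
  shows "Legendre (- x) p = Legendre x p"
  using Legendre_mult[OF assms(1,2), of "-1" x] Legendre_minus_1[OF assms(1,3)] by simp

section \<open>Reduced associates in fundamental domains\<close>

text \<open>Changing the sign of both coordinates suffices, since -1 is a square modulo
  \<open>p\<close>.\<close>

lemma gauss_reduced_associate:
  obtains x y :: int where "0 \<le> x" "x\<^sup>2 + y\<^sup>2 = a\<^sup>2 + b\<^sup>2"
    "\<And>p::nat. \<And>c. prime p \<Longrightarrow> 2 < p \<Longrightarrow> [p = (1::nat)] (mod 4) \<Longrightarrow> Legendre (x + c * y) p = Legendre (a + c * b) p"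
proof (cases "a \<ge> 0")
  case True
  then show ?thesis using that by blast
next
  case False
  have "Legendre (- a + c * (- b)) p = Legendre (a + c * b) p"
    if "prime p" "2 < p" "[p = (1::nat)] (mod 4)" for p :: nat and c
    using Legendre_uminus[OF that, of "a + c * b"] by simp
  then show ?thesis using that[of "-a" "-b"] False by simp
qed

text \<open>Multiplying by \<open>3 \<mp> 2\<surd>2 = (1 \<mp> \<surd>2)\<^sup>2\<close> changes neither norm nor residue symbol, and it
  decreases \<open>\<bar>b\<bar>\<close> until \<open>2 \<bar>b\<bar> \<le> a\<close>.\<close>

lemma sqrt2_reduced_associate:
  fixes a b :: int
  assumes "a\<^sup>2 - 2 * b\<^sup>2 > 0"
  shows "\<exists>x y. 2 * \<bar>y\<bar> \<le> x \<and> x\<^sup>2 - 2 * y\<^sup>2 = a\<^sup>2 - 2 * b\<^sup>2 \<and>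
    (\<forall>(p::nat) c. prime p \<longrightarrow> 2 < p \<longrightarrow> [p = (1::nat)] (mod 4) \<longrightarrow> int p dvd c\<^sup>2 - 2 \<longrightarrow>
       Legendre (x + c * y) p = Legendre (a + c * b) p)"
proof -
  have pos: "\<exists>x y. 2 * \<bar>y\<bar> \<le> x \<and> x\<^sup>2 - 2 * y\<^sup>2 = a\<^sup>2 - 2 * b\<^sup>2 \<and>
    (\<forall>(p::nat) c. prime p \<longrightarrow> 2 < p \<longrightarrow> int p dvd c\<^sup>2 - 2 \<longrightarrow>
       Legendre (x + c * y) p = Legendre (a + c * b) p)"
    if "a\<^sup>2 - 2 * b\<^sup>2 > 0" "a \<ge> 0" for a b :: int
    using that
  proof (induction "nat \<bar>b\<bar>" arbitrary: a b rule: less_induct)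
    case less
    show ?case
    proof (cases "2 * \<bar>b\<bar> \<le> a")
      case True
      then show ?thesis by blast
    next
      case False
      \<comment> \<open>The sign of \<open>b\<close> decides which of the two conjugate units to
        use: \<open>(a', b')\<close> is \<open>(a, b)\<close> times the square of
        \<open>1 - s * sqrt 2\<close>.\<close>
      define s where "s = sgn b"
      have s: "s * s = 1" "s * b = \<bar>b\<bar>" using False less.prems by (auto simp: s_def sgn_if)
      define a' where "a' = 3 * a - 4 * (s * b)"
      define b' where "b' = 3 * b - 2 * (s * a)"
      have sb': "s * b' = 3 * \<bar>b\<bar> - 2 * a"
      proof -
        have "s * b' = 3 * (s * b) - 2 * (s * s) * a" by (simp add: b'_def algebra_simps)
        then show ?thesis using s by simp
      qed
      \<comment> \<open>Together with \<open>a < 2 * \<bar>b\<bar>\<close> this makes the absolute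
        value of \<open>3 * \<bar>b\<bar> - 2 * a\<close> smaller than
        \<open>\<bar>b\<bar>\<close>.\<close>
      have ab: "\<bar>b\<bar> < a"
      proof (rule ccontr)
        assume "\<not> \<bar>b\<bar> < a"
        then have "a\<^sup>2 \<le> \<bar>b\<bar>\<^sup>2" using less.prems by (intro power_mono) auto
        then show False using less.prems zero_le_power2[of b] by simp
      qed
      have "\<bar>b'\<bar> = \<bar>s * b'\<bar>" using s(1) by (auto simp: abs_mult s_def sgn_if)
      also have "\<dots> < \<bar>b\<bar>" unfolding sb' using ab False by linarith
      finally have dec: "nat \<bar>b'\<bar> < nat \<bar>b\<bar>" by simp
      have a': "a' \<ge> 0"
      proof (rule ccontr)
        assume "\<not> a' \<ge> 0"
        then have "3 * a < 4 * \<bar>b\<bar>" using s by (simp add: a'_def)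
        then have "(3 * a)\<^sup>2 < (4 * \<bar>b\<bar>)\<^sup>2" using less.prems by (intro power_strict_mono) auto
        then have "9 * a\<^sup>2 < 16 * b\<^sup>2" by (simp add: power_mult_distrib)
        then show False using less.prems zero_le_power2[of b] by linarith
      qed
      have nrm: "a'\<^sup>2 - 2 * b'\<^sup>2 = a\<^sup>2 - 2 * b\<^sup>2"
      proof -
        have "a'\<^sup>2 - 2 * b'\<^sup>2 = 9 * a\<^sup>2 - 18 * b\<^sup>2 + (s * s) * (16 * b\<^sup>2 - 8 * a\<^sup>2)"
          by (simp add: a'_def b'_def power2_eq_square algebra_simps)
        then show ?thesis using s by simp
      qed
      have L: "Legendre (a' + c * b') p = Legendre (a + c * b) p"
        if p: "prime p" "2 < p" "int p dvd c\<^sup>2 - 2" for p :: nat and c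
      proof -
        have "a' + c * b' - (a + c * b) * ((1 - s * c) * (1 - s * c))
            = (c\<^sup>2 - 2) * (2 * s * b - (s * s) * (a + c * b)) + (2 - 2 * (s * s)) * (a + c * b)"
          by (simp add: a'_def b'_def power2_eq_square algebra_simps)
        then have "[a' + c * b' = (a + c * b) * ((1 - s * c) * (1 - s * c))] (mod int p)"
          using p(3) s(1) by (simp add: cong_iff_dvd_diff)
        \<comment> \<open>The reduction of a unit is a unit: the product of \<open>1 - s * c\<close>
          and \<open>1 + s * c\<close> is -1 modulo \<open>p\<close>.\<close>
        moreover have "\<not> int p dvd 1 - s * c"
        proof
          assume "int p dvd 1 - s * c"
          then have "int p dvd (1 - s * c) * (1 + s * c) + (c\<^sup>2 - 2)" using p(3) by simp
          moreover have "(1 - s * c) * (1 + s * c) + (c\<^sup>2 - 2) = -1 + (1 - s * s) * c\<^sup>2"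
            by (simp add: power2_eq_square algebra_simps)
          ultimately show False using s(1) p(1) by simp
        qed
        ultimately show ?thesis
          using Legendre_cong Legendre_mult[OF p(1,2)] Legendre_square[of "int p" "1 - s * c"] p(1) by simp
      qed
      obtain x y where "2 * \<bar>y\<bar> \<le> x" "x\<^sup>2 - 2 * y\<^sup>2 = a\<^sup>2 - 2 * b\<^sup>2"
        and "\<forall>(p::nat) c. prime p \<longrightarrow> 2 < p \<longrightarrow> int p dvd c\<^sup>2 - 2 \<longrightarrow>
          Legendre (x + c * y) p = Legendre (a' + c * b') p"
        using less.hyps[OF dec _ a', unfolded nrm, OF less.prems(1)] by blast
      then show ?thesis using L by (intro exI[of _ x] exI[of _ y]) auto
    qed
  qed
  show ?thesis
  proof (cases "a \<ge> 0")
    case True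
    then show ?thesis using pos[OF assms] by blast
  next
    case False
    then obtain x y where xy: "2 * \<bar>y\<bar> \<le> x" "x\<^sup>2 - 2 * y\<^sup>2 = a\<^sup>2 - 2 * b\<^sup>2"
      "\<And>p::nat. \<And>c. prime p \<Longrightarrow> 2 < p \<Longrightarrow> int p dvd c\<^sup>2 - 2 \<Longrightarrow> Legendre (x + c * y) p = Legendre (- a + c * (- b)) p"
      using pos[of "-a" "-b"] assms by auto
    have "Legendre (- a + c * (- b)) p = Legendre (a + c * b) p"
      if "prime p" "2 < p" "[p = (1::nat)] (mod 4)" for p :: nat and c
      using Legendre_uminus[OF that, of "a + c * b"] by simp
    with xy show ?thesis by (intro exI[of _ x] exI[of _ y]) auto
  qed
qed

text \<open>Hides the choice of \<open>d\<close>, so that the final argument treats the half-plane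
  and the cone alike.\<close>

lemma reduced_region:
  assumes "d \<in> {- 4, 8}"
  obtains Z N where "norm_region Z N"
    "\<And>a b. quad_norm d (a, b) > 0 \<Longrightarrow> \<exists>z\<in>Z. N z = quad_norm d (a, b) \<and>
      (\<forall>(p::nat) c. prime p \<longrightarrow> 2 < p \<longrightarrow> [p = (1::nat)] (mod 4) \<longrightarrow> int p dvd c\<^sup>2 - d div 4 \<longrightarrow>
         Legendre (fst z + c * snd z) p = Legendre (a + c * b) p)"
proof (cases "d = 8")
  case True
  show ?thesis
  proof (rule that[OF norm_region_sqrt2])
    fix a b assume "quad_norm d (a, b) > 0"
    then have "a\<^sup>2 - 2 * b\<^sup>2 > 0" using True by (simp add: quad_norm_def case_prod_beta)
    from sqrt2_reduced_associate[OF this] obtain x y where xy: "2 * \<bar>y\<bar> \<le> x"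
      "x\<^sup>2 - 2 * y\<^sup>2 = a\<^sup>2 - 2 * b\<^sup>2"
      "\<forall>(p::nat) c. prime p \<longrightarrow> 2 < p \<longrightarrow> [p = (1::nat)] (mod 4) \<longrightarrow> int p dvd c\<^sup>2 - 2 \<longrightarrow>
        Legendre (x + c * y) p = Legendre (a + c * b) p"
      by blast
    then show "\<exists>z\<in>{(x, y). 2 * \<bar>y\<bar> \<le> x}. (case z of (x, y) \<Rightarrow> x\<^sup>2 + (-2) * y\<^sup>2) = quad_norm d (a, b) \<and>
      (\<forall>(p::nat) c. prime p \<longrightarrow> 2 < p \<longrightarrow> [p = (1::nat)] (mod 4) \<longrightarrow> int p dvd c\<^sup>2 - d div 4 \<longrightarrow>
         Legendre (fst z + c * snd z) p = Legendre (a + c * b) p)"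
      using True by (intro bexI[of _ "(x, y)"]) (auto simp: quad_norm_def)
  qed
next
  case False
  then have d: "d = -4" using assms by simp
  show ?thesis
  proof (rule that[OF norm_region_gauss])
    fix a b
    obtain x y where xy: "0 \<le> x" "x\<^sup>2 + y\<^sup>2 = a\<^sup>2 + b\<^sup>2"
      "\<And>p::nat. \<And>c. prime p \<Longrightarrow> 2 < p \<Longrightarrow> [p = (1::nat)] (mod 4) \<Longrightarrow> Legendre (x + c * y) p = Legendre (a + c * b) p"
      using gauss_reduced_associate[of a b] by blast
    then show "\<exists>z\<in>{(x, y). 0 \<le> x}. (case z of (x, y) \<Rightarrow> x\<^sup>2 + 1 * y\<^sup>2) = quad_norm d (a, b) \<and>
      (\<forall>(p::nat) c. prime p \<longrightarrow> 2 < p \<longrightarrow> [p = (1::nat)] (mod 4) \<longrightarrow> int p dvd c\<^sup>2 - d div 4 \<longrightarrow>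
         Legendre (fst z + c * snd z) p = Legendre (a + c * b) p)"
      using d by (intro bexI[of _ "(x, y)"]) (auto simp: quad_norm_def)
  qed
qed

section \<open>Reduction of the theorem to the bilinear estimate\<close>

theorem theorem3p2:
  fixes d :: int and \<pi> :: "nat \<Rightarrow> int \<times> int"
    and r1 r2 :: nat and s1 s2 :: int and e1 e2 :: nat
  assumes "d \<in> {- 4, 8}"
    and "prime_choice d \<pi>"
    and "r1 \<in> {1, 9}" and "r2 \<in> {1, 9}"
    and "d = 8 \<longrightarrow> [r1 * r2 = 1] (mod 16)"
    and "s1 \<in> {- 1, 1}" and "s2 \<in> {- 1, 1}" and "s1 * s2 = 1"
    and "e1 \<in> {0, 1}" and "e2 \<in> {0, 1}" and "(e1, e2) \<noteq> (0, 0)"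
  shows "(\<lambda>X::real. \<Sum>(p, q) \<in> {(p, q). prime p \<and> prime q \<and> p < q \<and> real (p * q) \<le> X}.
            real_of_int (f_pq d \<pi> (r1, r2) (s1, s2) (e1, e2) p q))
         \<in> o[at_top](\<lambda>X. X * ln (ln X) / ln X)"
proof -
  define P where "P = {p. prime p \<and> [p = r1] (mod 16) \<and> chi2 d p = s1}"
  define Q where "Q = {q. prime q \<and> [q = r2] (mod 16) \<and> chi2 d q = s2}"
  define F where "F = (\<lambda>p q. real_of_int (f_pq d \<pi> (r1, r2) (s1, s2) (e1, e2) p q))"
  \<comment> \<open>The class modulo 8 makes \<open>prime_choice\<close> applicable; the class
    modulo 4 removes the signs in reciprocity and makes -1 a square.\<close>
  have mod8: "2 < p \<and> [p = (1::nat)] (mod 8) \<and> [p = (1::nat)] (mod 4)"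
    if "prime p" "[p = r] (mod 16)" "r \<in> {1, 9}" for p r :: nat
  proof -
    have "p mod 16 = 1 \<or> p mod 16 = 9" using that by (auto simp: unique_euclidean_semiring_class.cong_def)
    then have "p mod 8 = 1" "p mod 4 = 1" by presburger+
    moreover have "p \<noteq> 2" using \<open>p mod 4 = 1\<close> by auto
    ultimately show ?thesis using prime_ge_2_nat[OF that(1)]
      by (auto simp: unique_euclidean_semiring_class.cong_def)
  qed
  have P: "prime p \<and> 2 < p \<and> [p = (1::nat)] (mod 8) \<and> [p = (1::nat)] (mod 4)" if "p \<in> P" for p
    using that mod8[of p r1] assms(3) by (auto simp: P_def)
  have Q: "prime q \<and> 2 < q \<and> [q = (1::nat)] (mod 8) \<and> [q = (1::nat)] (mod 4)" if "q \<in> Q" for q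
    using that mod8[of q r2] assms(4) by (auto simp: Q_def)
  have norm: "quad_norm d (fst (\<pi> p), snd (\<pi> p)) = int p" if "prime p" "[p = (1::nat)] (mod 8)" for p
    using assms(2) that by (simp add: prime_choice_def)
  have F0: "F p q = 0" if "prime p" "prime q" "\<not> (p \<in> P \<and> q \<in> Q)" for p q
    using that by (auto simp: F_def f_pq_def P_def Q_def)
  have F_eq: "F p q = real_of_int (Legendre p q ^ e1 * eps d \<pi> p q ^ e2)" if "p \<in> P" "q \<in> Q" for p q
    using that by (simp add: F_def f_pq_def P_def Q_def)
  have swap: "Legendre p q = Legendre q p" if "p \<in> P" "q \<in> Q" "p < q" for p q
    using Legendre_swap[of p q] P[OF that(1)] Q[OF that(2)] that(3) by simp
  have goal: "(\<lambda>X::real. \<Sum>(p, q) \<in> {(p, q). prime p \<and> prime q \<and> p < q \<and> real (p * q) \<le> X}. F p q)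
      \<in> o[at_top](\<lambda>X. X * ln (ln X) / ln X)"
  proof (cases "e2 = 0")
    case True
    \<comment> \<open>Only the Legendre symbol is left, and by reciprocity it is the symbol of
      \<open>q\<close> modulo \<open>p\<close>; the lattice point is therefore
      \<open>(q, 0)\<close>.\<close>
    then have "e1 = 1" using assms(9,11) by auto
    interpret norm_region "{(x, y). y = 0 \<and> 1 \<le> x}" fst by (rule norm_region_nat)
    show ?thesis
    proof (rule prime_pair_sum_smallo[of P "\<lambda>_. 1" Q "\<lambda>q. (int q, 0)" _ "\<lambda>_. 0"])
      show "F p q = 1 * real_of_int (Legendre (fst (int q, 0) + 0 * snd (int q, 0::int)) (int p))"
        if "p \<in> P" "q \<in> Q" "p < q" for p q
        using F_eq[OF that(1,2)] swap[OF that] True \<open>e1 = 1\<close> by simp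
    qed (use P Q F0 in \<open>auto simp: prime_ge_Suc_0_nat\<close>)
  next
    case False
    then have e2: "e2 = 1" using assms(10) by auto
    obtain Z N where region: "norm_region Z N" and red:
      "\<And>a b. quad_norm d (a, b) > 0 \<Longrightarrow> \<exists>z\<in>Z. N z = quad_norm d (a, b) \<and>
        (\<forall>(p::nat) c. prime p \<longrightarrow> 2 < p \<longrightarrow> [p = (1::nat)] (mod 4) \<longrightarrow> int p dvd c\<^sup>2 - d div 4 \<longrightarrow>
           Legendre (fst z + c * snd z) p = Legendre (a + c * b) p)"
      using reduced_region[OF assms(1)] by blast
    interpret norm_region Z N by (rule region)
    have "\<forall>q\<in>Q. \<exists>z. z \<in> Z \<and> N z = int q \<and>
        (\<forall>(p::nat) c. prime p \<longrightarrow> 2 < p \<longrightarrow> [p = (1::nat)] (mod 4) \<longrightarrow> int p dvd c\<^sup>2 - d div 4 \<longrightarrow>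
           Legendre (fst z + c * snd z) p = Legendre (fst (\<pi> q) + c * snd (\<pi> q)) p)"
    proof
      fix q assume "q \<in> Q"
      then have n: "quad_norm d (fst (\<pi> q), snd (\<pi> q)) = int q" "q > 0" using Q[of q] norm[of q] by auto
      then have "0 < int q" by simp
      from red[of "fst (\<pi> q)" "snd (\<pi> q)", unfolded n(1), OF this]
      show "\<exists>z. z \<in> Z \<and> N z = int q \<and>
        (\<forall>(p::nat) c. prime p \<longrightarrow> 2 < p \<longrightarrow> [p = (1::nat)] (mod 4) \<longrightarrow> int p dvd c\<^sup>2 - d div 4 \<longrightarrow>
           Legendre (fst z + c * snd z) p = Legendre (fst (\<pi> q) + c * snd (\<pi> q)) p)" by blast
    qed
    then obtain \<zeta> where \<zeta>: "\<forall>q\<in>Q. \<zeta> q \<in> Z \<and> N (\<zeta> q) = int q \<and>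
        (\<forall>(p::nat) c. prime p \<longrightarrow> 2 < p \<longrightarrow> [p = (1::nat)] (mod 4) \<longrightarrow> int p dvd c\<^sup>2 - d div 4 \<longrightarrow>
           Legendre (fst (\<zeta> q) + c * snd (\<zeta> q)) p = Legendre (fst (\<pi> q) + c * snd (\<pi> q)) p)"
      unfolding bchoice_iff by blast
    have "\<forall>p\<in>P. \<exists>c. int p dvd fst (\<pi> p) + c * snd (\<pi> p) \<and> int p dvd c\<^sup>2 - d div 4"
    proof
      fix p assume p: "p \<in> P"
      have "(fst (\<pi> p))\<^sup>2 - (d div 4) * (snd (\<pi> p))\<^sup>2 = int p"
        using norm[of p] P[OF p] by (simp add: quad_norm_def case_prod_beta)
      then show "\<exists>c. int p dvd fst (\<pi> p) + c * snd (\<pi> p) \<and> int p dvd c\<^sup>2 - d div 4"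
        using exists_sqrt_mod_norm P[OF p] by metis
    qed
    then obtain c where c: "\<forall>p\<in>P. int p dvd fst (\<pi> p) + c p * snd (\<pi> p) \<and> int p dvd (c p)\<^sup>2 - d div 4"
      unfolding bchoice_iff by blast
    \<comment> \<open>This is the symbol of the conjugate of \<open>\<pi> p\<close> modulo
      \<open>\<pi> p\<close>, the part of \<open>eps\<close> that does not involve
      \<open>q\<close>.\<close>
    define A where "A = (\<lambda>p. real_of_int (Legendre (fst (\<pi> p) - c p * snd (\<pi> p)) p))"
    \<comment> \<open>For \<open>e1 = 0\<close> the symbol of the conjugate of
      \<open>\<pi> q\<close> remains, hence \<open>- c p\<close>. For \<open>e1 = 1\<close> the
      factor from \<open>q = N(z)\<close> contributes both conjugate symbols; one of them is squared
      away and \<open>c p\<close> remains.\<close>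
    define c' where "c' = (\<lambda>p. if e1 = 0 then - c p else c p)"
    show ?thesis
    proof (rule prime_pair_sum_smallo[of P A Q \<zeta> _ c'])
      fix p q assume pq: "p \<in> P" "q \<in> Q" "p < q"
      define x where "x = fst (\<pi> q)"
      define y where "y = snd (\<pi> q)"
      have cp: "int p dvd (c p)\<^sup>2 - d div 4" "int p dvd (- c p)\<^sup>2 - d div 4" using c pq by auto
      have \<zeta>q: "Legendre (fst (\<zeta> q) + u * snd (\<zeta> q)) p = Legendre (x + u * y) p"
        if "int p dvd u\<^sup>2 - d div 4" for u
        using \<zeta> pq P[OF pq(1)] that unfolding x_def y_def by blast
      have eps: "eps d \<pi> p q = Legendre (fst (\<pi> p) - c p * snd (\<pi> p)) p * Legendre (x - c p * y) p"
        unfolding x_def y_def using P[OF pq(1)] norm[of p] c pq by (intro eps_eq_Legendre) auto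
      have nq: "x\<^sup>2 - (d div 4) * y\<^sup>2 = int q" using norm[of q] Q[OF pq(2)] by (simp add: quad_norm_def case_prod_beta x_def y_def)
      have Lq: "Legendre q p = Legendre (x + c p * y) p * Legendre (x - c p * y) p"
        unfolding nq[symmetric] using P[OF pq(1)] cp by (intro Legendre_norm) auto
      \<comment> \<open>Nonvanishing of the symbol of \<open>q\<close> makes each of its two factors
        a sign, so that its square is exactly 1 and not 0.\<close>
      have "\<not> p dvd q" using P[OF pq(1)] Q[OF pq(2)] pq(3) primes_dvd_imp_eq by blast
      then have "Legendre q p \<noteq> 0" by (simp add: Legendre_eq_0_iff)
      then have sq: "Legendre (x - c p * y) p * Legendre (x - c p * y) p = 1"
        using Lq Legendre_cases[of "x - c p * y" p] by auto
      show "F p q = A p * real_of_int (Legendre (fst (\<zeta> q) + c' p * snd (\<zeta> q)) (int p))"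
      proof (cases "e1 = 0")
        case True
        then have "F p q = A p * real_of_int (Legendre (x + (- c p) * y) p)"
          using F_eq[OF pq(1,2)] e2 eps by (simp add: A_def)
        then show ?thesis using \<zeta>q[OF cp(2)] True by (simp add: c'_def)
      next
        case False
        then have "e1 = 1" using assms(9) by auto
        then have "F p q = real_of_int (Legendre (fst (\<pi> p) - c p * snd (\<pi> p)) p * Legendre (x + c p * y) p
            * (Legendre (x - c p * y) p * Legendre (x - c p * y) p))"
          using F_eq[OF pq(1,2)] swap[OF pq] e2 eps Lq by (simp add: mult_ac)
        then have "F p q = A p * real_of_int (Legendre (x + c p * y) p)" unfolding sq by (simp add: A_def)
        then show ?thesis using \<zeta>q[OF cp(1)] False by (simp add: c'_def)
      qed
    next
      fix p assume "p \<in> P"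
      moreover have "\<bar>A p\<bar> \<le> 1" using Legendre_cases[of "fst (\<pi> p) - c p * snd (\<pi> p)" p] by (auto simp: A_def)
      ultimately show "prime p \<and> 2 < p \<and> \<bar>A p\<bar> \<le> 1" using P by blast
    next
      fix q assume "q \<in> Q"
      then show "prime q \<and> \<zeta> q \<in> Z \<and> N (\<zeta> q) = int q" using Q \<zeta> by blast
    qed (rule F0)
  qed
  then show ?thesis by (simp only: F_def)
qed

end
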